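(* For $i\in\{1,\dots,n\}$ let $X_i$ be a spherical $t_i$-design in $S^{d-1}$, with $X_i\cap X_j=\emptyset$ for distinct $i,j$. For $i,j$ let $A(X_i,X_j)=\{\langle x,y\rangle: x\in X_i,y\in X_j,x\neq y\}$ and $s_{i,j}=|A(X_i,X_j)|$. Suppose that for every $i,j,h\in\{1,\dots,n\}$ at least one of the following holds: (1) $s_{i,j}+s_{j,h}-2\le t_j$; (2) $i=j=h$, $2s_{i,i}-3=t_i$ and $X_i=-X_i$. Then $\bigcup_{i=1}^nX_i$ with the relations $\{(x,x):x\in X_i\}$ ($1\le i\le n$) and $\{(x,y)\in X_i\times X_j:\langle x,y\rangle=\alpha\}$ ($1\le i,j\le n$, $\alpha\in A(X_i,X_j)$) is a $Q$-polynomial coherent configuration.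
   Context: $\langle\cdot,\cdot\rangle$ is the standard inner product on $\mathbb R^d$ and $S^{d-1}$ the unit sphere. A nonempty finite $Y\subset S^{d-1}$ is a spherical $t$-design if $\frac1{|Y|}\sum_{y\in Y}f(y)=\frac1{|S^{d-1}|}\int_{S^{d-1}}f\,d\sigma$ for every polynomial $f$ of degree at most $t$. Coherent configuration: pair $(Y,\mathcal R)$, $\mathcal R$ a partition of $Y\times Y$ into nonempty relations, closed under transpose, each relation meeting the diagonal contained in it, and $|\{z:(x,z)\in R,(z,y)\in R'\}|$ constant on each relation $R''$. Its fibers $Y_i$ are given by the diagonal relations; relations in $Y_i\times Y_j$ are labelled $R^{(i,j)}_\ell$, $\varepsilon_{i,j}\le\ell\le r_{i,j}$ ($\varepsilon_{i,j}=1-\delta_{i,j}$, $R^{(i,i)}_0$ diagonal, $(R^{(i,j)}_\ell)^\top=R^{(j,i)}_\ell$), $\tilde r_{i,j}=r_{i,j}-\varepsilon_{i,j}$, $A^{(i,j)}_\ell$ adjacency matrices, $\mathcal A^{(i,j)}$ their span, $\mathcal A$ the span of all. It is a $Q$-polynomial coherent configuration if each fiber is a symmetric association scheme and there is a basis $\{E^{(i,j)}_\ell: 0\le\ell\le\tilde r_{i,j}\}$ of $\mathcal A$ with (B1) $E^{(i,j)}_0=\frac{1}{\sqrt{|Y_i||Y_j|}}\times$(all-ones on $Y_i\times Y_j$, zero elsewhere); (B2) $\{E^{(i,j)}_\ell\}_\ell$ is a basis of $\mathcal A^{(i,j)}$; (B3) $(E^{(i,j)}_\ell)^\top=E^{(j,i)}_\ell$;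 (B4) $E^{(i,j)}_\ell E^{(i',j')}_{\ell'}=\delta_{\ell,\ell'}\delta_{j,i'}E^{(i,j')}_\ell$; and such that for all $i,j$ there are polynomials $v^{(i,j)}_h$ of degree $h$ ($0\le h\le\tilde r_{i,j}$) with $\sqrt{|Y_i||Y_j|}E^{(i,j)}_h=v^{(i,j)}_h(\sqrt{|Y_i||Y_j|}E^{(i,j)}_1)$, the polynomial evaluated with the entrywise product (zeroth power = all-ones matrix on $Y_i\times Y_j$). *)

theory Defs
  imports "HOL-Analysis.Analysis" "HOL-Library.Function_Algebras" "HOL-Library.Disjoint_Sets"
begin

section \<open>Spherical designs\<close>

text \<open>Surface measure on the unit sphere, in polar coordinates: the measure of \<open>A\<close> is \<open>d\<close> times the
  Lebesgue measure of the cone \<open>{r *\<^sub>R x | r x. 0 < r \<and> r < 1 \<and> x \<in> A}\<close> over \<open>A\<close>, i.e. \<open>d\<close> times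
  the image of the Lebesgue measure on the punctured unit ball under \<open>sgn x = x /\<^sub>R norm x\<close>. It is
  a Borel measure on the whole space that is concentrated on \<open>sphere 0 1\<close>.\<close>

definition surface_measure :: "(real ^ 'd) measure" where
  "surface_measure =
     scale_measure (of_nat CARD('d))
       (distr (restrict_space lborel (ball 0 1 - {0})) borel sgn)"

definition polynomial_of_degree_le :: "nat \<Rightarrow> (real ^ 'd \<Rightarrow> real) \<Rightarrow> bool" where
  "polynomial_of_degree_le t f \<longleftrightarrow>
     (\<exists>(M :: ('d \<Rightarrow> nat) set) (c :: ('d \<Rightarrow> nat) \<Rightarrow> real).
        finite M \<and> (\<forall>e\<in>M. (\<Sum>k\<in>UNIV. e k) \<le> t) \<and>
        f = (\<lambda>x. \<Sum>e\<in>M. c e * (\<Prod>k\<in>UNIV. (x $ k) ^ e k)))"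

definition spherical_design :: "nat \<Rightarrow> (real ^ 'd) set \<Rightarrow> bool" where
  "spherical_design t Y \<longleftrightarrow>
     finite Y \<and> Y \<noteq> {} \<and> Y \<subseteq> sphere 0 1 \<and>
     (\<forall>f. polynomial_of_degree_le t f \<longrightarrow>
        (1 / real (card Y)) * (\<Sum>y\<in>Y. f y) =
        (1 / measure surface_measure (sphere 0 1 :: (real ^ 'd) set)) *
          (LINT x : sphere 0 1 | surface_measure. f x))"

definition inner_products :: "(real ^ 'd) set \<Rightarrow> (real ^ 'd) set \<Rightarrow> real set" where
  "inner_products Y Z = {x \<bullet> y | x y. x \<in> Y \<and> y \<in> Z \<and> x \<noteq> y}"


section \<open>Coherent configurations\<close>

definition coherent_configuration :: "'a set \<Rightarrow> ('a \<times> 'a) set set \<Rightarrow> bool" where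
  "coherent_configuration Y \<R> \<longleftrightarrow>
     finite Y \<and> partition_on (Y \<times> Y) \<R> \<and>
     (\<forall>R\<in>\<R>. R\<inverse> \<in> \<R>) \<and>
     (\<forall>R\<in>\<R>. R \<inter> Id_on Y \<noteq> {} \<longrightarrow> R \<subseteq> Id_on Y) \<and>
     (\<forall>R\<in>\<R>. \<forall>R'\<in>\<R>. \<forall>R''\<in>\<R>. \<exists>p. \<forall>(x, y)\<in>R''.
        card {z. (x, z) \<in> R \<and> (z, y) \<in> R'} = p)"

definition fibers :: "('a \<times> 'a) set set \<Rightarrow> 'a set set" where
  "fibers \<R> = {F. Id_on F \<in> \<R>}"

definition relations_between ::
    "('a \<times> 'a) set set \<Rightarrow> 'a set \<Rightarrow> 'a set \<Rightarrow> ('a \<times> 'a) set set" where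
  "relations_between \<R> F G = {R \<in> \<R>. R \<subseteq> F \<times> G}"

text \<open>The number \<open>r - \<epsilon>\<close>. Between two fibers the relations are labelled \<open>\<epsilon>, \<dots>, r\<close>, so there are
  \<open>r - \<epsilon> + 1\<close> of them, both for \<open>F = G\<close> (\<open>\<epsilon> = 0\<close>) and for \<open>F \<noteq> G\<close> (\<open>\<epsilon> = 1\<close>).\<close>

definition rtilde :: "('a \<times> 'a) set set \<Rightarrow> 'a set \<Rightarrow> 'a set \<Rightarrow> nat" where
  "rtilde \<R> F G = card (relations_between \<R> F G) - 1"

definition symmetric_association_scheme :: "'a set \<Rightarrow> ('a \<times> 'a) set set \<Rightarrow> bool" where
  "symmetric_association_scheme Y \<R> \<longleftrightarrow>
     coherent_configuration Y \<R> \<and> Id_on Y \<in> \<R> \<and> (\<forall>R\<in>\<R>. R\<inverse> = R)"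


section \<open>Matrices\<close>

text \<open>A real matrix with rows and columns indexed by \<open>Y\<close> is a function \<open>'a \<Rightarrow> 'a \<Rightarrow> real\<close> vanishing
  outside \<open>Y \<times> Y\<close>; addition and zero are pointwise.\<close>

global_interpretation matrices: vector_space "\<lambda>(c :: real) (M :: 'a \<Rightarrow> 'a \<Rightarrow> real) x y. c * M x y"
  by unfold_locales (auto simp: fun_eq_iff algebra_simps)

definition adjacency :: "('a \<times> 'a) set \<Rightarrow> 'a \<Rightarrow> 'a \<Rightarrow> real" where
  "adjacency R x y = of_bool ((x, y) \<in> R)"

definition matrix_prod ::
    "'a set \<Rightarrow> ('a \<Rightarrow> 'a \<Rightarrow> real) \<Rightarrow> ('a \<Rightarrow> 'a \<Rightarrow> real) \<Rightarrow> 'a \<Rightarrow> 'a \<Rightarrow> real" where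
  "matrix_prod Y M N x y = (\<Sum>z\<in>Y. M x z * N z y)"

definition matrix_transpose :: "('a \<Rightarrow> 'a \<Rightarrow> real) \<Rightarrow> 'a \<Rightarrow> 'a \<Rightarrow> real" where
  "matrix_transpose M x y = M y x"

definition all_ones :: "'a set \<Rightarrow> 'a set \<Rightarrow> 'a \<Rightarrow> 'a \<Rightarrow> real" where
  "all_ones F G x y = of_bool (x \<in> F \<and> y \<in> G)"

definition matrix_smult :: "real \<Rightarrow> ('a \<Rightarrow> 'a \<Rightarrow> real) \<Rightarrow> 'a \<Rightarrow> 'a \<Rightarrow> real" where
  "matrix_smult c M x y = c * M x y"

text \<open>A polynomial evaluated at an \<open>F \<times> G\<close> block with respect to the entrywise product; the
  zeroth power is \<open>all_ones F G\<close>.\<close>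

definition entrywise_poly ::
    "'a set \<Rightarrow> 'a set \<Rightarrow> real poly \<Rightarrow> ('a \<Rightarrow> 'a \<Rightarrow> real) \<Rightarrow> 'a \<Rightarrow> 'a \<Rightarrow> real" where
  "entrywise_poly F G p M x y = (if x \<in> F \<and> y \<in> G then poly p (M x y) else 0)"

definition is_basis :: "('i \<Rightarrow> 'a \<Rightarrow> 'a \<Rightarrow> real) \<Rightarrow> 'i set \<Rightarrow> ('a \<Rightarrow> 'a \<Rightarrow> real) set \<Rightarrow> bool" where
  "is_basis B I V \<longleftrightarrow>
     inj_on B I \<and> \<not> matrices.dependent (B ` I) \<and> matrices.span (B ` I) = V"


section \<open>Q-polynomial coherent configurations\<close>

text \<open>The double index \<open>(i,j)\<close> is replaced by the pair \<open>(F,G)\<close> of fibers itself. Only the values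
  \<open>E F G l\<close> with fibers \<open>F\<close>, \<open>G\<close> and \<open>l \<le> rtilde \<R> F G\<close> are meaningful. Accordingly the fourth
  condition of \<open>block_basis\<close> includes that the matrix \<open>E F G' l\<close> on its right-hand side is one
  of these. The product of basis elements with different middle fibers or different lower
  indices is zero.\<close>

definition block_basis ::
    "'a set \<Rightarrow> ('a \<times> 'a) set set \<Rightarrow> ('a set \<Rightarrow> 'a set \<Rightarrow> nat \<Rightarrow> 'a \<Rightarrow> 'a \<Rightarrow> real) \<Rightarrow> bool" where
  "block_basis Y \<R> E \<longleftrightarrow>
     is_basis (\<lambda>(F, G, l). E F G l)
       {(F, G, l). F \<in> fibers \<R> \<and> G \<in> fibers \<R> \<and> l \<le> rtilde \<R> F G}
       (matrices.span (adjacency ` \<R>)) \<and>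
     (\<forall>F\<in>fibers \<R>. \<forall>G\<in>fibers \<R>.
        E F G 0 = matrix_smult (1 / sqrt (real (card F) * real (card G))) (all_ones F G)) \<and>
     (\<forall>F\<in>fibers \<R>. \<forall>G\<in>fibers \<R>.
        is_basis (E F G) {..rtilde \<R> F G}
          (matrices.span (adjacency ` relations_between \<R> F G))) \<and>
     (\<forall>F\<in>fibers \<R>. \<forall>G\<in>fibers \<R>. \<forall>l\<le>rtilde \<R> F G.
        matrix_transpose (E F G l) = E G F l) \<and>
     (\<forall>F\<in>fibers \<R>. \<forall>G\<in>fibers \<R>. \<forall>F'\<in>fibers \<R>. \<forall>G'\<in>fibers \<R>.
      \<forall>l\<le>rtilde \<R> F G. \<forall>l'\<le>rtilde \<R> F' G'.
        if l = l' \<and> G = F'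
        then l \<le> rtilde \<R> F G' \<and> matrix_prod Y (E F G l) (E F' G' l') = E F G' l
        else matrix_prod Y (E F G l) (E F' G' l') = 0)"

text \<open>If \<open>rtilde \<R> F G = 0\<close>, then only \<open>h = 0\<close> occurs below; \<open>v 0\<close> is constant, so the value of
  \<open>E F G 1\<close> is irrelevant.\<close>

definition Q_polynomial_coherent_configuration :: "'a set \<Rightarrow> ('a \<times> 'a) set set \<Rightarrow> bool" where
  "Q_polynomial_coherent_configuration Y \<R> \<longleftrightarrow>
     coherent_configuration Y \<R> \<and>
     (\<forall>F\<in>fibers \<R>. symmetric_association_scheme F (relations_between \<R> F F)) \<and>
     (\<exists>E. block_basis Y \<R> E \<and>
        (\<forall>F\<in>fibers \<R>. \<forall>G\<in>fibers \<R>. \<exists>v :: nat \<Rightarrow> real poly. \<forall>h\<le>rtilde \<R> F G.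
           degree (v h) = h \<and>
           matrix_smult (sqrt (real (card F) * real (card G))) (E F G h) =
             entrywise_poly F G (v h)
               (matrix_smult (sqrt (real (card F) * real (card G))) (E F G 1))))"


section \<open>The relations on a union of spherical designs\<close>

definition design_relations ::
    "nat \<Rightarrow> (nat \<Rightarrow> (real ^ 'd) set) \<Rightarrow> ((real ^ 'd) \<times> (real ^ 'd)) set set" where
  "design_relations n X =
     {{(x, x) | x. x \<in> X i} | i. i \<in> {1..n}} \<union>
     {{(x, y). x \<in> X i \<and> y \<in> X j \<and> x \<bullet> y = \<alpha>} | i j \<alpha>.
        i \<in> {1..n} \<and> j \<in> {1..n} \<and> \<alpha> \<in> inner_products (X i) (X j)}"

end

theory Submission
  imports Defs
begin

text \<open>The spherical integral of \<open>(v \<bullet> z) ^ k\<close> over \<open>z\<close> does not depend on the unit vector \<open>v\<close>; so for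
  every \<open>t\<close>-design the power sums of \<open>v \<bullet> z\<close> up to degree \<open>t\<close> are universal constants, and this is the
  only consequence of the design property that is needed. It implies that averaging
  \<open>f (x \<bullet> z) * g (z \<bullet> y)\<close> over a design gives a polynomial in \<open>x \<bullet> y\<close> that does not depend on the
  design. Orthogonalising the monomials with respect to this convolution product yields Gegenbauer
  polynomials \<open>G k\<close> with \<open>G k * G l = \<delta> G k\<close>; the addition formula for spherical harmonics is not
  required. The kernels \<open>G l (x \<bullet> y)\<close> provide all the idempotents between distinct \<open>X i\<close>, \<open>X j\<close>, and
  all but one (two, in the antipodal case) of those within \<open>X i\<close>; the missing ones are found by
  subtraction from the identity (from its even and odd parts). As the kernels have degrees
  \<open>0, 1, 2, \<dots>\<close>, they span all functions of the inner product, whence the relations span an algebra.\<close>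

section \<open>Rotation invariance of the surface measure\<close>

text \<open>The obstacle is that the designs differ in strength, and a convolution over
  \<open>X j\<close> is controlled only up to total degree \<open>t j\<close>. Clause (1) says that
  the top degrees \<open>s i j - 1\<close> and \<open>s j h - 1\<close> of two adjacent blocks add
  up to at most \<open>t j\<close>. A block between distinct designs has \<open>s i j\<close>
  relations, so degrees below \<open>s i j\<close> suffice. A diagonal block also contains the
  identity relation and needs a kernel of degree \<open>s i i\<close>, for which \<open>X i\<close>
  may be too weak; the identity, written as an interpolation polynomial in the inner product, makes
  up for it. In clause (2) the strength is one short already for degree \<open>s i i - 1\<close>,
  and parity has to help. The delicate point is consistency: a path from \<open>X i\<close> through
  another \<open>X j\<close> back to \<open>X i\<close> may produce a Gegenbauer kernel of the very
  degree for which the diagonal block uses the subtracted one, and the two must agree on all inner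
  products within \<open>X i\<close>. Finally, high degrees are not always available: on a line,
  unit vectors have only the inner products 1 and -1. Hence the degree bound \<open>K\<close> is
  tied to a block with enough inner products.\<close>

lemma nn_integral_lborel_translation:
  fixes f :: "'a::euclidean_space \<Rightarrow> ennreal"
  assumes [measurable]: "f \<in> borel_measurable borel"
  shows "(\<integral>\<^sup>+x. f (c + x) \<partial>lborel) = (\<integral>\<^sup>+x. f x \<partial>lborel)"
proof -
  have "(\<integral>\<^sup>+x. f x \<partial>lborel) = (\<integral>\<^sup>+x. f x \<partial>(distr lborel borel ((+) c)))"
    by (simp add: lborel_distr_plus)
  also have "\<dots> = (\<integral>\<^sup>+x. f (c + x) \<partial>lborel)"
    by (subst nn_integral_distr) auto
  finally show ?thesis ..
qed

lemma borel_measurable_orthogonal: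
  fixes T :: "'a::euclidean_space \<Rightarrow> 'a"
  shows "orthogonal_transformation T \<Longrightarrow> T \<in> borel_measurable borel"
  by (intro borel_measurable_continuous_onI linear_continuous_on
      linear_conv_bounded_linear[THEN iffD1] orthogonal_transformation_linear)

text \<open>Translation invariance alone makes Lebesgue measure invariant under \<open>T\<close> up to a constant
  factor; the unit ball, which \<open>T\<close> preserves, shows that the factor is \<open>1\<close>.\<close>

lemma nn_integral_lborel_orthogonal:
  fixes T :: "'a::euclidean_space \<Rightarrow> 'a" and f :: "'a::euclidean_space \<Rightarrow> ennreal"
  assumes T: "orthogonal_transformation T" and f [measurable]: "f \<in> borel_measurable borel"
  shows "(\<integral>\<^sup>+x. f (T x) \<partial>lborel) = (\<integral>\<^sup>+x. f x \<partial>lborel)"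
proof -
  let ?B = "ball (0::'a) 1"
  have lin: "linear T" using T by (rule orthogonal_transformation_linear)
  have [measurable]: "T \<in> borel_measurable borel"
    using T by (rule borel_measurable_orthogonal)
  have norm_T: "norm (T x) = norm x" for x
    using T by (simp add: orthogonal_transformation_norm)
  obtain S where S: "\<And>y. T (S y) = y"
    using orthogonal_transformation_surj[OF T] by (metis surjD)
  have [measurable]: "?B \<in> sets borel" by simp
  have indicator_B: "(indicator ?B :: 'a \<Rightarrow> ennreal) \<in> borel_measurable borel"
    by (intro borel_measurable_indicator) simp
  have "emeasure lborel ?B * (\<integral>\<^sup>+x. f (T x) \<partial>lborel)
      = (\<integral>\<^sup>+x. f (T x) * (\<integral>\<^sup>+y. indicator ?B y \<partial>lborel) \<partial>lborel)"
    by (subst nn_integral_multc) (simp_all add: mult.commute)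
  also have "\<dots> = (\<integral>\<^sup>+x. f (T x) * (\<integral>\<^sup>+y. indicator ?B (- T x + y) \<partial>lborel) \<partial>lborel)"
    by (simp only: nn_integral_lborel_translation[OF indicator_B])
  also have "\<dots> = (\<integral>\<^sup>+x. (\<integral>\<^sup>+y. f (T x) * indicator ?B (- T x + y) \<partial>lborel) \<partial>lborel)"
    by (intro nn_integral_cong nn_integral_cmult[symmetric]) measurable
  also have "\<dots> = (\<integral>\<^sup>+y. (\<integral>\<^sup>+x. f (T x) * indicator ?B (- T x + y) \<partial>lborel) \<partial>lborel)"
    by (rule lborel_pair.Fubini') measurable
  \<comment> \<open>For fixed \<open>y\<close> the variable \<open>x\<close> is shifted by the
    preimage \<open>S y\<close>. Then \<open>T (S y + x) = y + T x\<close>, and the indicator is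
    evaluated at \<open>- T x\<close>, which lies in the ball exactly when \<open>x\<close>
    does.\<close>
  also have "\<dots> = (\<integral>\<^sup>+y. (\<integral>\<^sup>+x. f (T (S y + x)) * indicator ?B (- T (S y + x) + y) \<partial>lborel) \<partial>lborel)"
    by (intro nn_integral_cong nn_integral_lborel_translation[symmetric]) measurable
  also have "\<dots> = (\<integral>\<^sup>+y. (\<integral>\<^sup>+x. f (T x + y) * indicator ?B x \<partial>lborel) \<partial>lborel)"
    by (intro nn_integral_cong) (auto simp: linear_add[OF lin] S norm_T indicator_def add.commute)
  also have "\<dots> = (\<integral>\<^sup>+x. (\<integral>\<^sup>+y. f (T x + y) * indicator ?B x \<partial>lborel) \<partial>lborel)"
    by (rule lborel_pair.Fubini') measurable
  also have "\<dots> = (\<integral>\<^sup>+x. (\<integral>\<^sup>+y. f y \<partial>lborel) * indicator ?B x \<partial>lborel)"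
    by (intro nn_integral_cong) (simp add: nn_integral_multc nn_integral_lborel_translation[OF f])
  also have "\<dots> = emeasure lborel ?B * (\<integral>\<^sup>+y. f y \<partial>lborel)"
    by (subst nn_integral_cmult) (simp_all add: mult.commute)
  finally have "emeasure lborel ?B * (\<integral>\<^sup>+x. f (T x) \<partial>lborel)
      = emeasure lborel ?B * (\<integral>\<^sup>+y. f y \<partial>lborel)" .
  moreover have "emeasure lborel ?B \<noteq> 0"
    using content_ball_pos[of 1 "0 :: 'a"] by (auto simp: measure_def)
  moreover have "emeasure lborel ?B < top"
    using emeasure_bounded_finite[of ?B] by simp
  ultimately show ?thesis
    by (auto simp: ennreal_mult_cancel_left)
qed

lemma lborel_distr_orthogonal:
  assumes T: "orthogonal_transformation (T :: 'a::euclidean_space \<Rightarrow> 'a)"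
  shows "distr lborel borel T = lborel"
proof (rule measure_eqI)
  have [measurable]: "T \<in> borel_measurable borel"
    using T by (rule borel_measurable_orthogonal)
  fix A assume "A \<in> sets (distr lborel borel T)"
  then have [measurable]: "A \<in> sets borel" by simp
  have "emeasure (distr lborel borel T) A = (\<integral>\<^sup>+x. indicator A (T x) \<partial>lborel)"
    by (subst nn_integral_indicator[symmetric], simp, subst nn_integral_distr) auto
  then show "emeasure (distr lborel borel T) A = emeasure lborel A"
    by (simp add: nn_integral_lborel_orthogonal[OF T])
qed simp

text \<open>\<open>T\<close> commutes with \<open>sgn\<close> and preserves the punctured ball, so
  the cone over the preimage of a set is the preimage of the cone over it, and the invariance of
  Lebesgue measure applies.\<close>

lemma surface_measure_distr_orthogonal:
  fixes T :: "real ^ 'd \<Rightarrow> real ^ 'd"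
  assumes T: "orthogonal_transformation T"
  shows "distr surface_measure borel T = (surface_measure :: (real ^ 'd) measure)"
proof (rule measure_eqI)
  show "sets (distr surface_measure borel T) = sets (surface_measure :: (real ^ 'd) measure)"
    by (simp add: surface_measure_def)
  have lin: "linear T" using T by (rule orthogonal_transformation_linear)
  have T_meas [measurable]: "T \<in> borel_measurable borel"
    using T by (rule borel_measurable_orthogonal)
  have norm_T: "norm (T x) = norm x" for x
    using T by (simp add: orthogonal_transformation_norm)
  have T0: "T x = 0 \<longleftrightarrow> x = 0" for x
    using norm_T[of x] by (metis norm_eq_zero)
  have sgn_T: "sgn (T x) = T (sgn x)" for x
    by (simp add: sgn_div_norm norm_T linear_cmul[OF lin])
  have sgn_meas [measurable]: "sgn \<in> borel_measurable (borel :: (real^'d) measure)"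
    by (simp add: sgn_div_norm[abs_def])
  have [measurable]: "sgn \<in> measurable (restrict_space lborel (ball 0 1 - {0}))
      (borel :: (real^'d) measure)"
    by (intro measurable_restrict_space1) (simp add: sgn_meas)
  have cone: "emeasure surface_measure A
      = of_nat CARD('d) * emeasure lborel ({w. sgn w \<in> A} \<inter> (ball 0 1 - {0}))"
    if [measurable]: "A \<in> sets borel" for A :: "(real ^ 'd) set"
    unfolding surface_measure_def
    by (simp add: emeasure_distr emeasure_restrict_space space_restrict_space vimage_def Int_commute)
  fix A :: "(real ^ 'd) set" assume "A \<in> sets (distr surface_measure borel T)"
  then have A [measurable]: "A \<in> sets borel" by simp
  have TA [measurable]: "{w. T w \<in> A} \<in> sets borel"
    using measurable_sets[OF T_meas A] by (simp add: vimage_def)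
  have [measurable]: "{w :: real ^ 'd. sgn w \<in> A} \<in> sets borel"
    using measurable_sets[OF sgn_meas A] by (simp add: vimage_def)
  have "emeasure (distr surface_measure borel T) A = emeasure surface_measure {w. T w \<in> A}"
    by (subst emeasure_distr) (auto simp: surface_measure_def vimage_def)
  also have "\<dots> = of_nat CARD('d) * emeasure lborel ({w. T (sgn w) \<in> A} \<inter> (ball 0 1 - {0}))"
    by (simp only: cone[OF TA] mem_Collect_eq)
  also have "emeasure lborel ({w. T (sgn w) \<in> A} \<inter> (ball 0 1 - {0}))
      = emeasure (distr lborel borel T) ({w. sgn w \<in> A} \<inter> (ball 0 1 - {0}))"
    by (subst emeasure_distr) (auto simp: norm_T T0 sgn_T intro!: arg_cong2[where f = emeasure])
  finally show "emeasure (distr surface_measure borel T) A = emeasure surface_measure A"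
    by (simp add: lborel_distr_orthogonal[OF T] cone)
qed

lemma surface_integral_orthogonal:
  fixes T :: "real ^ 'd \<Rightarrow> real ^ 'd" and f :: "real ^ 'd \<Rightarrow> real"
  assumes T: "orthogonal_transformation T" and f [measurable]: "f \<in> borel_measurable borel"
  shows "(LINT x : sphere 0 1 | surface_measure. f (T x))
      = (LINT x : sphere 0 1 | surface_measure. f x)"
proof -
  have "T \<in> borel_measurable borel"
    using T by (rule borel_measurable_orthogonal)
  then have [measurable]: "T \<in> measurable surface_measure borel"
    by (simp add: surface_measure_def cong: measurable_cong_sets)
  have "(LINT x : sphere 0 1 | surface_measure. f x)
      = (\<integral>x. indicator (sphere 0 1) x *\<^sub>R f x \<partial>(distr surface_measure borel T))"
    by (simp add: surface_measure_distr_orthogonal[OF T] set_lebesgue_integral_def)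
  also have "\<dots> = (\<integral>x. indicator (sphere 0 1) (T x) *\<^sub>R f (T x) \<partial>surface_measure)"
    by (subst integral_distr) (auto intro!: borel_measurable_times borel_measurable_indicator)
  also have "\<dots> = (LINT x : sphere 0 1 | surface_measure. f (T x))"
    using T by (simp add: set_lebesgue_integral_def indicator_def orthogonal_transformation_norm)
  finally show ?thesis ..
qed

section \<open>Powers of a linear form as polynomials of bounded degree\<close>

lemma polynomial_of_degree_le_const: "polynomial_of_degree_le t (\<lambda>x. a)"
  unfolding polynomial_of_degree_le_def
  by (intro exI[of _ "{\<lambda>_. 0}"] exI[of _ "\<lambda>_. a"]) auto

lemma polynomial_of_degree_le_add:
  assumes "polynomial_of_degree_le t f" "polynomial_of_degree_le t g"
  shows "polynomial_of_degree_le t (\<lambda>x. f x + g x)"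
proof -
  obtain M c where M: "finite M" "\<forall>e\<in>M. (\<Sum>k\<in>UNIV. e k) \<le> t"
    and f: "f = (\<lambda>x. \<Sum>e\<in>M. c e * (\<Prod>k\<in>UNIV. (x $ k) ^ e k))"
    using assms(1) unfolding polynomial_of_degree_le_def by blast
  obtain M' c' where M': "finite M'" "\<forall>e\<in>M'. (\<Sum>k\<in>UNIV. e k) \<le> t"
    and g: "g = (\<lambda>x. \<Sum>e\<in>M'. c' e * (\<Prod>k\<in>UNIV. (x $ k) ^ e k))"
    using assms(2) unfolding polynomial_of_degree_le_def by blast
  let ?c = "\<lambda>e. (if e \<in> M then c e else 0) + (if e \<in> M' then c' e else 0)"
  have "(\<Sum>e\<in>M. c e * m e) = (\<Sum>e\<in>M \<union> M'. (if e \<in> M then c e else 0) * m e)"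
    "(\<Sum>e\<in>M'. c' e * m e) = (\<Sum>e\<in>M \<union> M'. (if e \<in> M' then c' e else 0) * m e)" for m :: "_ \<Rightarrow> real"
    using M(1) M'(1) by (auto intro!: sum.mono_neutral_cong_left)
  then have "(\<lambda>x. f x + g x) = (\<lambda>x. \<Sum>e\<in>M \<union> M'. ?c e * (\<Prod>k\<in>UNIV. (x $ k) ^ e k))"
    unfolding f g by (auto simp: fun_eq_iff sum.distrib distrib_right)
  with M M' show ?thesis
    unfolding polynomial_of_degree_le_def
    by (intro exI[of _ "M \<union> M'"] exI[of _ ?c]) auto
qed

lemma polynomial_of_degree_le_mult_component:
  fixes f :: "real ^ 'd \<Rightarrow> real"
  assumes "polynomial_of_degree_le t f"
  shows "polynomial_of_degree_le (Suc t) (\<lambda>x. a * x $ i * f x)"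
proof -
  obtain M c where M: "finite M" "\<forall>e\<in>M. (\<Sum>k\<in>UNIV. e k) \<le> t"
    and f: "f = (\<lambda>x. \<Sum>e\<in>M. c e * (\<Prod>k\<in>UNIV. (x $ k) ^ e k))"
    using assms(1) unfolding polynomial_of_degree_le_def by blast
  define u d where "u = (\<lambda>e. e(i := Suc (e i)))" and "d = (\<lambda>e. e(i := e i - 1 :: nat))"
  have du: "d (u e) = e" for e
    by (simp add: u_def d_def)
  then have inj: "inj_on u M"
    by (metis inj_onI)
  have prod_u: "(\<Prod>k\<in>UNIV. (x $ k) ^ u e k) = x $ i * (\<Prod>k\<in>UNIV. (x $ k) ^ e k)"
    for e and x :: "real ^ 'd"
    by (simp add: u_def prod.remove[of UNIV i] mult.assoc)
  have "(\<lambda>x. a * x $ i * f x) = (\<lambda>x. \<Sum>e\<in>u ` M. a * c (d e) * (\<Prod>k\<in>UNIV. (x $ k) ^ e k))"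
    unfolding f
    by (simp add: fun_eq_iff sum.reindex[OF inj] sum_distrib_left du prod_u mult.assoc
        mult.left_commute)
  moreover have "(\<Sum>k\<in>UNIV. u e k) = Suc (\<Sum>k\<in>UNIV. e k)" for e
    by (simp add: u_def sum.remove[of UNIV i])
  ultimately show ?thesis
    using M unfolding polynomial_of_degree_le_def
    by (intro exI[of _ "u ` M"] exI[of _ "\<lambda>e. a * c (d e)"]) auto
qed

lemma polynomial_of_degree_le_sum:
  assumes "finite I" "\<And>i. i \<in> I \<Longrightarrow> polynomial_of_degree_le t (f i)"
  shows "polynomial_of_degree_le t (\<lambda>x. \<Sum>i\<in>I. f i x)"
  using assms
  by (induction I rule: finite_induct) (simp_all add: polynomial_of_degree_le_const
      polynomial_of_degree_le_add)

lemma polynomial_of_degree_le_inner_power: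
  "k \<le> t \<Longrightarrow> polynomial_of_degree_le t (\<lambda>x. (v \<bullet> x) ^ k)"
proof (induction k arbitrary: t)
  case (Suc k)
  then obtain t' where "t = Suc t'" "k \<le> t'" by (cases t) auto
  with Suc.IH[of t'] show ?case
    by (simp add: inner_vec_def sum_distrib_right polynomial_of_degree_le_sum
        polynomial_of_degree_le_mult_component)
qed (simp add: polynomial_of_degree_le_const)

section \<open>Moments of spherical designs\<close>

text \<open>The constants \<open>m\<close> are a parameter and not existentially bound, so that
  several designs of different strengths can share them.\<close>

definition power_moments :: "(nat \<Rightarrow> real) \<Rightarrow> nat \<Rightarrow> 'a::real_inner set \<Rightarrow> bool" where
  "power_moments m t Z \<longleftrightarrow> finite Z \<and> Z \<noteq> {} \<and> Z \<subseteq> sphere 0 1 \<and>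
     (\<forall>k\<le>t. \<forall>v. norm v = 1 \<longrightarrow> (\<Sum>z\<in>Z. (v \<bullet> z) ^ k) = real (card Z) * m k)"

lemma spherical_design_power_moments:
  obtains m where "\<And>t Y. spherical_design t (Y :: (real ^ 'd) set) \<Longrightarrow> power_moments m t Y"
proof -
  obtain e :: "real ^ 'd" where e: "norm e = 1"
    using norm_axis_1 by blast
  let ?I = "\<lambda>v :: real ^ 'd. \<lambda>k. (1 / measure surface_measure (sphere 0 1 :: (real ^ 'd) set)) *
          (LINT x : sphere 0 1 | surface_measure. (v \<bullet> x) ^ k)"
  have I: "?I v k = ?I e k" if v: "norm v = 1" for v k
  proof -
    obtain T where T: "orthogonal_transformation T" "T v = e"
      using orthogonal_transformation_exists_1[OF v e] .
    have "(v \<bullet> x) ^ k = (e \<bullet> T x) ^ k" for x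
      using T by (metis orthogonal_transformation_def)
    then show ?thesis
      using surface_integral_orthogonal[OF T(1), of "\<lambda>x. (e \<bullet> x) ^ k"] by simp
  qed
  have "power_moments (?I e) t Y" if Y: "spherical_design t Y" for t and Y :: "(real ^ 'd) set"
    unfolding power_moments_def
  proof (intro conjI allI impI)
    fix k v assume k: "k \<le> t" and v: "norm (v :: real ^ 'd) = 1"
    have "(1 / real (card Y)) * (\<Sum>y\<in>Y. (v \<bullet> y) ^ k) = ?I v k"
      using Y polynomial_of_degree_le_inner_power[OF k] unfolding spherical_design_def by blast
    moreover have "card Y \<noteq> 0" using Y by (simp add: spherical_design_def)
    ultimately show "(\<Sum>y\<in>Y. (v \<bullet> y) ^ k) = real (card Y) * ?I e k"
      unfolding I[OF v] by (simp add: field_simps)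
  qed (use Y in \<open>auto simp: spherical_design_def\<close>)
  then show ?thesis by (rule that)
qed

lemma unit_inner_eq_1_iff:
  fixes x y :: "'a::real_inner"
  assumes "norm x = 1" "norm y = 1"
  shows "x \<bullet> y = 1 \<longleftrightarrow> x = y"
  using norm_cauchy_schwarz_eq[of x y] assms by (auto simp: dot_square_norm)

lemma power_momentsD:
  assumes "power_moments m t Z"
  shows "finite Z" "Z \<noteq> {}" "card Z > 0" "\<And>z. z \<in> Z \<Longrightarrow> norm z = 1"
  using assms by (auto simp: power_moments_def card_gt_0_iff)

lemma power_moments_sum:
  assumes Z: "power_moments m t Z" and k: "k \<le> t"
  shows "(\<Sum>z\<in>Z. (v \<bullet> z) ^ k) = real (card Z) * m k * norm v ^ k"
proof (cases "v = 0")
  case False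
  have "v \<bullet> z = norm v * (sgn v \<bullet> z)" for z
    using False by (simp add: sgn_div_norm)
  then have "(\<Sum>z\<in>Z. (v \<bullet> z) ^ k) = norm v ^ k * (\<Sum>z\<in>Z. (sgn v \<bullet> z) ^ k)"
    by (metis (no_types, lifting) power_mult_distrib sum.cong sum_distrib_left)
  also have "(\<Sum>z\<in>Z. (sgn v \<bullet> z) ^ k) = real (card Z) * m k"
    using Z k False by (simp add: power_moments_def norm_sgn)
  finally show ?thesis by simp
next
  \<comment> \<open>Only \<open>k = 0\<close> is delicate: as \<open>0 ^ 0 = 1\<close>, the claim
    becomes \<open>m 0 = 1\<close>, which is read off at any unit vector \<open>e\<close>.\<close>
  case True
  obtain e where e: "e \<in> Z" "norm e = 1"
    using power_momentsD[OF Z] by blast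
  have "(\<Sum>z\<in>Z. (e \<bullet> z) ^ 0) = real (card Z) * m 0"
    using Z e unfolding power_moments_def by blast
  then show ?thesis
    using True power_momentsD(3)[OF Z] by (cases "k = 0") auto
qed

text \<open>The power sums at \<open>e\<close> and \<open>- e\<close> are equal because
  \<open>m\<close> does not depend on the vector, and opposite because \<open>k\<close> is
  odd.\<close>

lemma power_moments_odd:
  assumes Z: "power_moments m t Z" and k: "k \<le> t" "odd k"
  shows "m k = 0"
proof -
  obtain e where e: "norm e = 1" "e \<in> Z"
    using power_momentsD[OF Z] by blast
  have "(\<Sum>z\<in>Z. ((- e) \<bullet> z) ^ k) = - (\<Sum>z\<in>Z. (e \<bullet> z) ^ k)"
    using k by (simp add: sum_negf)
  then have "real (card Z) * m k = 0"
    using power_moments_sum[OF Z k(1), of e] power_moments_sum[OF Z k(1), of "- e"] e by simp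
  then show ?thesis
    using power_momentsD(3)[OF Z] by simp
qed

text \<open>The trinomial is the squared norm of \<open>\<alpha> *\<^sub>R x + y\<close> for unit
  vectors with inner product \<open>u\<close>. Every factor \<open>u\<close> comes with a factor
  \<alpha>, so the coefficient of degree \<open>j\<close> in \<alpha> has degree at most
  \<open>j\<close> in \<open>u\<close>.\<close>

lemma trinomial_power_coeff:
  "\<exists>q :: real poly. degree q \<le> j \<and> (\<forall>u. poly q u = coeff ([:1, 2 * u, 1:] ^ k) j)"
proof (induction k arbitrary: j)
  case 0
  show ?case
    by (intro exI[of _ "[:if j = 0 then 1 else 0:]"]) auto
next
  case (Suc k)
  obtain q where q: "\<And>j. degree (q j) \<le> j" "\<And>j u. poly (q j :: real poly) u
      = coeff ([:1, 2 * u, 1:] ^ k) j"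
    using Suc.IH by metis
  consider "j = 0" | "j = 1" | i where "j = Suc (Suc i)"
    by (metis One_nat_def not0_implies_Suc)
  then show ?case
  proof cases
    case 1
    then show ?thesis
      using q by (intro exI[of _ "q 0"]) auto
  next
    case 2
    have "degree (q 1 + [:0, 2:] * q 0) \<le> 1"
      using q(1)[of 0] q(1)[of 1] degree_mult_le[of "[:0, 2:]" "q 0"]
      by (intro degree_add_le) auto
    then show ?thesis
      using 2 q by (intro exI[of _ "q 1 + [:0, 2:] * q 0"]) (auto simp: mult.commute mult.left_commute)
  next
    case 3
    have "degree (q j + [:0, 2:] * q (Suc i) + q i) \<le> j"
      using q(1)[of i] q(1)[of j] q(1)[of "Suc i"] degree_mult_le[of "[:0, 2:]" "q (Suc i)"] 3
      by (intro degree_add_le) auto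
    then show ?thesis
      using 3 q by (intro exI[of _ "q j + [:0, 2:] * q (Suc i) + q i"]) (auto simp: algebra_simps)
  qed
qed

text \<open>Comparing coefficients of \<open>\<alpha>\<close> in the moment identity at \<open>\<alpha> *\<^sub>R x + y\<close> yields all mixed moments.\<close>

lemma mixed_moment_left:
  "\<exists>q. degree q \<le> a \<and> (\<forall>t Z (x :: 'a::real_inner) y. power_moments m t Z \<longrightarrow> a + b \<le> t \<longrightarrow>
      norm x = 1 \<longrightarrow> norm y = 1 \<longrightarrow>
     (\<Sum>z\<in>Z. (x \<bullet> z) ^ a * (y \<bullet> z) ^ b) = real (card Z) * poly q (x \<bullet> y))"
proof -
  let ?n = "a + b"
  define k where "k = ?n div 2"
  obtain q where q: "degree q \<le> a" "\<And>u. poly (q :: real poly) u = coeff ([:1, 2 * u, 1:] ^ k) a"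
    using trinomial_power_coeff by blast
  \<comment> \<open>For even \<open>?n\<close> the norm power is a power of the trinomial. For odd
    \<open>?n\<close> it need not be a polynomial in \<alpha>, but then its factor
    \<open>m ?n\<close> vanishes. The binomial coefficient is the one that accompanies the mixed
    moment in the expansion.\<close>
  define r where "r = smult ((if even ?n then m ?n else 0) / real (?n choose a)) q"
  have "(\<Sum>z\<in>Z. (x \<bullet> z) ^ a * (y \<bullet> z) ^ b) = real (card Z) * poly r (x \<bullet> y)"
    if Z: "power_moments m t Z" and t: "?n \<le> t" and x: "norm x = 1" and y: "norm y = 1"
    for t Z and x y :: 'a
  proof -
    define P where "P = (\<Sum>j\<le>?n. monom (real (?n choose j) * (\<Sum>z\<in>Z. (x \<bullet> z) ^ j * (y \<bullet> z) ^
        (?n - j))) j)"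
    define Q where "Q = smult (real (card Z) * (if even ?n then m ?n else 0))
        ([:1, 2 * (x \<bullet> y), 1:] ^ k)"
    have "poly P \<alpha> = poly Q \<alpha>" for \<alpha>
    proof -
      have "poly P \<alpha> = (\<Sum>z\<in>Z. \<Sum>j\<le>?n. real (?n choose j) * (\<alpha> * (x \<bullet> z)) ^ j * (y \<bullet> z) ^ (?n - j))"
        unfolding P_def
        by (subst sum.swap) (simp add: poly_sum poly_monom sum_distrib_left power_mult_distrib mult_ac)
      also have "\<dots> = (\<Sum>z\<in>Z. ((\<alpha> *\<^sub>R x + y) \<bullet> z) ^ ?n)"
        by (simp add: binomial_ring inner_add_left)
      also have "\<dots> = real (card Z) * m ?n * norm (\<alpha> *\<^sub>R x + y) ^ ?n"
        by (rule power_moments_sum[OF Z t])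
      also have "\<dots> = poly Q \<alpha>"
      proof (cases "even ?n")
        case True
        have "norm (\<alpha> *\<^sub>R x + y) ^ ?n = ((\<alpha> *\<^sub>R x + y) \<bullet> (\<alpha> *\<^sub>R x + y)) ^ k"
          using True by (simp add: k_def dot_square_norm flip: power_mult)
        also have "(\<alpha> *\<^sub>R x + y) \<bullet> (\<alpha> *\<^sub>R x + y) = poly [:1, 2 * (x \<bullet> y), 1:] \<alpha>"
        proof -
          have "x \<bullet> x = 1" "y \<bullet> y = 1" using x y by (simp_all add: dot_square_norm)
          then show ?thesis
            by (simp add: inner_add_left inner_add_right inner_commute[of y x] algebra_simps)
        qed
        finally show ?thesis
          using True by (simp add: Q_def)
      next
        case False
        then show ?thesis
          using power_moments_odd[OF Z t] by (simp add: Q_def)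
      qed
      finally show ?thesis .
    qed
    then have "P = Q"
      by (simp add: poly_eq_poly_eq_iff[symmetric] fun_eq_iff)
    then have "coeff P a = coeff Q a" by simp
    moreover have "coeff P a = real (?n choose a) * (\<Sum>z\<in>Z. (x \<bullet> z) ^ a * (y \<bullet> z) ^ b)"
      by (simp add: P_def coeff_sum)
    moreover have "coeff Q a = real (?n choose a) * (real (card Z) * poly r (x \<bullet> y))"
      by (simp add: Q_def r_def q)
    moreover have "real (?n choose a) \<noteq> 0" by simp
    ultimately show ?thesis by simp
  qed
  moreover have "degree r \<le> a"
    unfolding r_def using q(1) degree_smult_le le_trans by blast
  ultimately show ?thesis by blast
qed

text \<open>The roles of \<open>x\<close> and \<open>y\<close> can be exchanged, so the smaller
  exponent gives the bound. The minimum matters: it makes a convolution inherit the lower of the two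
  degrees, on which all orthogonality arguments rest.\<close>

lemma mixed_moment:
  "\<exists>q. degree q \<le> min a b \<and> (\<forall>t Z (x :: 'a::real_inner) y. power_moments m t Z \<longrightarrow> a + b \<le> t
      \<longrightarrow> norm x = 1 \<longrightarrow> norm y = 1 \<longrightarrow>
     (\<Sum>z\<in>Z. (x \<bullet> z) ^ a * (y \<bullet> z) ^ b) = real (card Z) * poly q (x \<bullet> y))"
proof (cases "a \<le> b")
  case True
  then show ?thesis using mixed_moment_left[of a m b] by (simp add: min_def)
next
  case False
  obtain q where q: "degree q \<le> b" "\<And>t Z (x :: 'a) y. power_moments m t Z \<Longrightarrow> b + a \<le> t \<Longrightarrow>
      norm x = 1 \<Longrightarrow> norm y = 1 \<Longrightarrow>
     (\<Sum>z\<in>Z. (x \<bullet> z) ^ b * (y \<bullet> z) ^ a) = real (card Z) * poly q (x \<bullet> y)"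
    using mixed_moment_left[of b m a] by blast
  have "(\<Sum>z\<in>Z. (x \<bullet> z) ^ a * (y \<bullet> z) ^ b) = real (card Z) * poly q (x \<bullet> y)"
    if "power_moments m t Z" "a + b \<le> t" "norm x = 1" "norm y = 1" for t Z and x y :: 'a
    using q(2)[of t Z y x] that by (simp add: mult.commute inner_commute add.commute)
  with q(1) False show ?thesis by auto
qed

lemma zonal_convolution_exists:
  "\<exists>r. degree r \<le> min (degree f) (degree g) \<and>
     (\<forall>t Z (x :: 'a::real_inner) y. power_moments m t Z \<longrightarrow> degree f + degree g \<le> t \<longrightarrow>
         norm x = 1 \<longrightarrow> norm y = 1 \<longrightarrow>
     (\<Sum>z\<in>Z. poly f (x \<bullet> z) * poly g (z \<bullet> y)) = real (card Z) * poly r (x \<bullet> y))"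
proof -
  obtain q where q: "\<And>a b. degree (q a b) \<le> min a b"
      "\<And>a b t Z (x :: 'a) y. power_moments m t Z \<Longrightarrow> a + b \<le> t \<Longrightarrow> norm x = 1 \<Longrightarrow> norm y = 1 \<Longrightarrow>
     (\<Sum>z\<in>Z. (x \<bullet> z) ^ a * (y \<bullet> z) ^ b) = real (card Z) * poly (q a b) (x \<bullet> y)"
    using mixed_moment[where 'a = 'a and m = m] by metis
  define r where "r = (\<Sum>i\<le>degree f. \<Sum>j\<le>degree g. smult (coeff f i * coeff g j) (q i j))"
  have "degree r \<le> min (degree f) (degree g)"
    unfolding r_def
  proof (intro degree_sum_le finite_atMost)
    fix i j assume "i \<in> {..degree f}" "j \<in> {..degree g}"
    then show "degree (smult (coeff f i * coeff g j) (q i j)) \<le> min (degree f) (degree g)"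
      using q(1)[of i j] degree_smult_le[of "coeff f i * coeff g j" "q i j"] by auto
  qed
  moreover have "(\<Sum>z\<in>Z. poly f (x \<bullet> z) * poly g (z \<bullet> y)) = real (card Z) * poly r (x \<bullet> y)"
    if "power_moments m t Z" "degree f + degree g \<le> t" "norm x = 1" "norm y = 1" for t Z and x y :: 'a
  proof -
    have "(\<Sum>z\<in>Z. poly f (x \<bullet> z) * poly g (z \<bullet> y))
      = (\<Sum>z\<in>Z. \<Sum>i\<le>degree f. \<Sum>j\<le>degree g. coeff f i * coeff g j * ((x \<bullet> z) ^ i * (y \<bullet> z) ^ j))"
      by (simp add: poly_altdef sum_product mult_ac inner_commute[of _ y])
    also have "\<dots> = (\<Sum>i\<le>degree f. \<Sum>j\<le>degree g. coeff f i * coeff g j * (\<Sum>z\<in>Z. (x \<bullet> z) ^ i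
        * (y \<bullet> z) ^ j))"
      by (simp add: sum_distrib_left sum.swap[of _ Z])
    also have "\<dots> = (\<Sum>i\<le>degree f. \<Sum>j\<le>degree g. coeff f i * coeff g j
        * (real (card Z) * poly (q i j) (x \<bullet> y)))"
      using that by (intro sum.cong refl) (simp add: q(2))
    also have "\<dots> = real (card Z) * poly r (x \<bullet> y)"
      by (simp add: r_def poly_sum sum_distrib_left mult_ac)
    finally show ?thesis .
  qed
  ultimately show ?thesis by blast
qed

section \<open>Gegenbauer polynomials\<close>

text \<open>Leading terms are eliminated from the top. The disjunction is there because the zero
  polynomial has \<open>degree\<close> 0, so that \<open>degree f < N\<close> alone would exclude it
  for \<open>N = 0\<close>.\<close>

lemma poly_triangular_expansion:
  fixes g :: "nat \<Rightarrow> 'a::field poly"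
  assumes g: "\<And>l. l < N \<Longrightarrow> degree (g l) = l \<and> g l \<noteq> 0"
  shows "N = 0 \<and> f = 0 \<or> degree f < N \<Longrightarrow> \<exists>c. f = (\<Sum>l<N. smult (c l) (g l))"
  using g
proof (induction N arbitrary: f)
  case (Suc N)
  define a where "a = coeff f N / coeff (g N) N"
  have gN: "degree (g N) = N" "g N \<noteq> 0" using Suc.prems(2)[of N] by auto
  then have c: "coeff (g N) N \<noteq> 0"
    by (metis leading_coeff_0_iff)
  define h where "h = f - smult a (g N)"
  have "degree h \<le> N"
    unfolding h_def using Suc.prems(1) gN degree_smult_le[of a "g N"]
    by (intro degree_diff_le) auto
  moreover have "coeff h N = 0"
    using c by (simp add: h_def a_def)
  ultimately have "N = 0 \<and> h = 0 \<or> degree h < N"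
    by (metis bot_nat_0.not_eq_extremum degree_0 le_degree leading_coeff_0_iff nat_less_le)
  then obtain c where "h = (\<Sum>l<N. smult (c l) (g l))"
    using Suc.IH[of h] Suc.prems(2) by auto
  then have "f = (\<Sum>l<N. smult (c l) (g l)) + smult a (g N)"
    by (simp add: h_def diff_eq_eq)
  also have "\<dots> = (\<Sum>l<Suc N. smult ((c(N := a)) l) (g l))"
    by simp
  finally show ?case by blast
qed simp

text \<open>\<open>Z\<close> is a reference design over which convolutions of polynomials of degree
  up to \<open>K\<close> can be evaluated. \<open>separating\<close> turns equality of zonal
  functions into equality of polynomials; in dimension 1 it restricts \<open>K\<close> to at most
  1.\<close>

locale zonal =
  fixes m :: "nat \<Rightarrow> real" and T :: nat and Z :: "(real ^ 'd) set" and K :: nat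
  assumes Z: "power_moments m T Z"
    and KT: "2 * K \<le> T"
    and separating: "\<And>p. degree p \<le> K \<Longrightarrow>
      (\<And>x y :: real ^ 'd. norm x = 1 \<Longrightarrow> norm y = 1 \<Longrightarrow> poly p (x \<bullet> y) = 0) \<Longrightarrow> p = 0"
begin

text \<open>The choice is independent of the design, since \<open>t\<close> and \<open>Z\<close> are
  bound inside it. For degrees up to \<open>K\<close> it is unique, by evaluation over the reference
  design and \<open>separating\<close>.\<close>

definition convolution :: "real poly \<Rightarrow> real poly \<Rightarrow> real poly" where
  "convolution f g = (SOME r. degree r \<le> min (degree f) (degree g) \<and>
     (\<forall>t Z (x :: real ^ 'd) y. power_moments m t Z \<longrightarrow> degree f + degree g \<le> t \<longrightarrow> norm x = 1 \<longrightarrow> norm y = 1 \<longrightarrow>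
     (\<Sum>z\<in>Z. poly f (x \<bullet> z) * poly g (z \<bullet> y)) = real (card Z) * poly r (x \<bullet> y)))"

lemma convolution_spec:
  "degree (convolution f g) \<le> min (degree f) (degree g) \<and>
     (\<forall>t Z (x :: real ^ 'd) y. power_moments m t Z \<longrightarrow> degree f + degree g \<le> t \<longrightarrow> norm x = 1 \<longrightarrow> norm y = 1 \<longrightarrow>
     (\<Sum>z\<in>Z. poly f (x \<bullet> z) * poly g (z \<bullet> y)) = real (card Z) * poly (convolution f g) (x \<bullet> y))"
  unfolding convolution_def by (rule someI_ex[OF zonal_convolution_exists])

lemma degree_convolution: "degree (convolution f g) \<le> degree f" "degree (convolution f g) \<le> degree g"
  using convolution_spec[of f g] by simp_all

lemma sum_convolution:
  "power_moments m t Y \<Longrightarrow> degree f + degree g \<le> t \<Longrightarrow> norm x = 1 \<Longrightarrow> norm y = 1 \<Longrightarrow>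
     (\<Sum>z\<in>Y. poly f (x \<bullet> z) * poly g (z \<bullet> (y :: real ^ 'd)))
         = real (card Y) * poly (convolution f g) (x \<bullet> y)"
  using convolution_spec[of f g] by blast

lemma zonal_poly_eqI:
  assumes "degree p \<le> K" "degree q \<le> K"
    and "\<And>x y :: real ^ 'd. norm x = 1 \<Longrightarrow> norm y = 1 \<Longrightarrow> poly p (x \<bullet> y) = poly q (x \<bullet> y)"
  shows "p = q"
  using separating[of "p - q"] assms by (simp add: degree_diff_le)

section \<open>The inner product on zonal polynomials and its orthogonal polynomials\<close>

definition pole :: "real ^ 'd" where "pole = (SOME z. z \<in> Z)"

lemma norm_pole: "norm pole = 1"
  unfolding pole_def using power_momentsD[OF Z] by (metis some_in_eq)

lemma card_Z: "card Z > 0" and finite_Z: "finite Z" and norm_Z: "z \<in> Z \<Longrightarrow> norm z = 1"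
  using power_momentsD[OF Z] by auto

text \<open>A discrete form of the inner product with Gegenbauer weight. By
  \<open>pairing_convolution\<close> it is a convolution evaluated at 1, so for degrees up to
  \<open>K\<close> any other unit vector would serve as \<open>pole\<close>.\<close>

definition pairing :: "real poly \<Rightarrow> real poly \<Rightarrow> real" where
  "pairing f g = (\<Sum>z\<in>Z. poly f (pole \<bullet> z) * poly g (z \<bullet> pole))"

lemma pairing_commute: "pairing f g = pairing g f"
  by (simp add: pairing_def inner_commute[of _ pole] mult.commute)

lemma pairing_add: "pairing (f + f') g = pairing f g + pairing f' g"
  and pairing_diff: "pairing (f - f') g = pairing f g - pairing f' g"
  and pairing_smult: "pairing (smult c f) g = c * pairing f g"
  by (simp_all add: pairing_def distrib_right left_diff_distrib sum.distrib sum_subtractf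
      sum_distrib_left mult.assoc)

lemma pairing_sum: "pairing (sum f I) g = (\<Sum>i\<in>I. pairing (f i) g)"
  by (induction I rule: infinite_finite_induct) (simp_all add: pairing_add, simp_all add: pairing_def)

lemma pairing_convolution:
  "degree f \<le> K \<Longrightarrow> degree g \<le> K \<Longrightarrow> pairing f g = real (card Z) * poly (convolution f g) 1"
  using sum_convolution[OF Z, of f g pole pole] KT norm_pole by (simp add: pairing_def dot_square_norm)

text \<open>Vanishing at one pole says only that \<open>f\<close> is zero at finitely many inner
  products. But the value is the same at every pole, so \<open>f (v \<bullet> z)\<close> vanishes
  for all unit vectors \<open>v\<close> and all \<open>z\<close> in \<open>Z\<close>; rotating an
  arbitrary \<open>y\<close> into \<open>Z\<close> reaches all pairs of unit vectors.\<close>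

lemma pairing_pos:
  assumes f: "degree f \<le> K" "f \<noteq> 0"
  shows "pairing f f > 0"
proof (rule ccontr)
  assume "\<not> pairing f f > 0"
  moreover have "pairing f f \<ge> 0"
    by (simp add: pairing_def inner_commute[of _ pole] sum_nonneg)
  ultimately have B0: "pairing f f = 0" by simp
  have "f = 0"
  proof (rule separating[OF f(1)])
    fix x y :: "real ^ 'd" assume x: "norm x = 1" and y: "norm y = 1"
    have "(\<Sum>z\<in>Z. poly f (v \<bullet> z) * poly f (z \<bullet> v)) = pairing f f" if "norm v = 1" for v
      using sum_convolution[OF Z, of f f v v] f(1) KT that pairing_convolution[of f f]
      by (simp add: dot_square_norm)
    then have "(\<Sum>z\<in>Z. poly f (v \<bullet> z) * poly f (v \<bullet> z)) = 0" if "norm v = 1" for v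
      using that B0 by (metis (no_types, lifting) inner_commute sum.cong)
    then have zero: "poly f (v \<bullet> z) = 0" if "norm v = 1" "z \<in> Z" for v z
      using that finite_Z by (auto simp: sum_nonneg_eq_0_iff)
    obtain z where z: "z \<in> Z" using card_Z by (metis card_gt_0_iff ex_in_conv)
    obtain S where S: "orthogonal_transformation S" "S y = z"
      using orthogonal_transformation_exists_1[OF y norm_Z[OF z]] .
    have "x \<bullet> y = S x \<bullet> z" using S by (metis orthogonal_transformation_def)
    moreover have "norm (S x) = 1" using S x by (simp add: orthogonal_transformation_norm)
    ultimately show "poly f (x \<bullet> y) = 0" using zero z by simp
  qed
  with f show False by simp
qed

text \<open>Both sides are the double sum of \<open>f (pole \<bullet> w) * g (w \<bullet> z) * h (z
  \<bullet> pole)\<close>, divided by \<open>card Z\<close>.\<close>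

lemma pairing_associative:
  assumes "degree f \<le> K" "degree g \<le> K" "degree h \<le> K"
  shows "pairing (convolution f g) h = pairing f (convolution g h)"
proof -
  have "real (card Z) * pairing (convolution f g) h
      = (\<Sum>z\<in>Z. (\<Sum>w\<in>Z. poly f (pole \<bullet> w) * poly g (w \<bullet> z)) * poly h (z \<bullet> pole))"
    unfolding pairing_def sum_distrib_left using assms KT norm_pole norm_Z
    by (intro sum.cong refl) (simp add: sum_convolution[OF Z])
  also have "\<dots> = (\<Sum>w\<in>Z. poly f (pole \<bullet> w) * (\<Sum>z\<in>Z. poly g (w \<bullet> z) * poly h (z \<bullet> pole)))"
    unfolding sum_distrib_left sum_distrib_right by (subst sum.swap) (simp add: mult.assoc)
  also have "\<dots> = (\<Sum>w\<in>Z. poly f (pole \<bullet> w) * (real (card Z) * poly (convolution g h) (w \<bullet> pole)))"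
    using assms KT norm_pole norm_Z by (intro sum.cong refl) (simp add: sum_convolution[OF Z])
  also have "\<dots> = real (card Z) * pairing f (convolution g h)"
    by (simp add: pairing_def sum_distrib_left mult.left_commute)
  finally show ?thesis using card_Z by simp
qed

lemma orthogonal_polynomial_exists:
  "k \<le> K \<Longrightarrow> \<exists>p. degree p = k \<and> p \<noteq> 0 \<and> (\<forall>f. degree f < k \<longrightarrow> pairing p f = 0)"
proof (induction k rule: less_induct)
  case (less k)
  obtain P where P: "\<And>l. l < k \<Longrightarrow> degree (P l) = l \<and> P l \<noteq> 0"
      and P': "\<And>l f. l < k \<Longrightarrow> degree f < l \<Longrightarrow> pairing (P l) f = 0"
    using less.IH less.prems by (metis less_or_eq_imp_le order_trans)
  define X :: "real poly" where "X = monom 1 k"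
  define S where "S = (\<Sum>l<k. smult (pairing X (P l) / pairing (P l) (P l)) (P l))"
  define p where "p = X - S"
  have X: "degree X = k" "coeff X k = 1" by (simp_all add: X_def degree_monom_eq)
  have S: "k = 0 \<and> S = 0 \<or> degree S < k"
  proof (cases k)
    case 0
    then show ?thesis by (simp add: S_def)
  next
    case (Suc k')
    have "degree S \<le> k'"
      unfolding S_def using P Suc
      by (intro degree_sum_le) (auto intro: order_trans[OF degree_smult_le])
    with Suc show ?thesis by simp
  qed
  then have "coeff S k = 0" using coeff_eq_0 by auto
  then have ck: "coeff p k = 1" by (simp add: p_def X)
  have "degree p \<le> k"
    unfolding p_def using S X by (intro degree_diff_le) auto
  with ck have "degree p = k"
    by (metis le_antisym le_degree zero_neq_one)
  moreover have "p \<noteq> 0" using ck by auto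
  moreover have "pairing p f = 0" if f: "degree f < k" for f
  proof -
    have orth: "pairing (P l) (P j) = 0" if "l < k" "j < k" "l \<noteq> j" for l j
      using P' P that by (metis pairing_commute nat_neq_iff)
    have pP: "pairing p (P j) = 0" if j: "j < k" for j
    proof -
      have "pairing S (P j) = (\<Sum>l<k. if l = j then pairing X (P j) else 0)"
        unfolding S_def pairing_sum pairing_smult using pairing_pos[of "P j"] P[OF j] j less.prems orth
        by (intro sum.cong refl) auto
      then show ?thesis using j by (simp add: p_def pairing_diff)
    qed
    obtain c where "f = (\<Sum>l<k. smult (c l) (P l))"
      using poly_triangular_expansion[of k P f] P f by blast
    then show ?thesis
      by (simp add: pairing_commute[of p] pairing_sum pairing_smult pP[unfolded pairing_commute[of p]])
  qed
  ultimately show ?case by blast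
qed

text \<open>With \<open>r\<close> the convolution of \<open>p\<close> and \<open>f\<close>,
  associativity moves one \<open>r\<close> across:
  \<open>pairing r r = pairing p (convolution f r)\<close>. The second argument has degree below
  that of \<open>p\<close>, so this is 0 and positivity forces \<open>r = 0\<close>.\<close>

lemma convolution_orthogonal:
  assumes p: "degree p \<le> K" "\<And>f. degree f < degree p \<Longrightarrow> pairing p f = 0" and f: "degree f < degree p"
  shows "convolution p f = 0"
proof (rule ccontr)
  let ?r = "convolution p f"
  assume "?r \<noteq> 0"
  moreover have r: "degree ?r \<le> degree f" by (rule degree_convolution)
  ultimately have "pairing ?r ?r > 0" using f p(1) by (intro pairing_pos) auto
  moreover have "pairing ?r ?r = pairing p (convolution f ?r)"
    using r f p(1) by (intro pairing_associative) auto
  moreover have "pairing p (convolution f ?r) = 0"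
    using degree_convolution(1)[of f ?r] f by (intro p(2)) auto
  ultimately show False by simp
qed

text \<open>\<open>convolution p p\<close> is again orthogonal to all polynomials of lower degree, hence a multiple of \<open>p\<close>.\<close>

lemma convolution_idempotent_exists:
  assumes k: "k \<le> K"
  shows "\<exists>G. degree G = k \<and> G \<noteq> 0 \<and> convolution G G = G \<and> (\<forall>f. degree f < k \<longrightarrow> convolution G f = 0)"
proof -
  obtain p where p: "degree p = k" "p \<noteq> 0" and orth: "\<And>f. degree f < k \<Longrightarrow> pairing p f = 0"
    using orthogonal_polynomial_exists[OF k] by blast
  have conv0: "convolution p f = 0" if "degree f < k" for f
    using convolution_orthogonal[of p f] p k orth that by auto
  define r where "r = convolution p p"
  have degr: "degree r \<le> k" using degree_convolution[of p p] p by (simp add: r_def)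
  have r_orth: "pairing r f = 0" if f: "degree f < k" for f
  proof -
    have "pairing r f = pairing p (convolution p f)"
      unfolding r_def using f p k by (intro pairing_associative) auto
    then show ?thesis by (simp add: conv0[OF f] pairing_def)
  qed
  \<comment> \<open>With this quotient the top terms of \<open>r\<close> and
    \<open>smult c p\<close> cancel. Their difference has degree below \<open>k\<close> and is
    orthogonal to all such polynomials, hence to itself.\<close>
  define c where "c = coeff r k / coeff p k"
  have pk: "coeff p k \<noteq> 0" using p by (metis leading_coeff_0_iff)
  have "r - smult c p = 0"
  proof (rule ccontr)
    let ?h = "r - smult c p"
    assume h: "?h \<noteq> 0"
    have hk: "degree ?h \<le> k" using degr p degree_smult_le[of c p] by (intro degree_diff_le) auto
    have "coeff ?h k = 0" using pk by (simp add: c_def)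
    with h hk have "degree ?h < k"
      by (metis leading_coeff_0_iff order_le_less)
    then have "pairing ?h ?h = 0"
      by (simp add: pairing_diff pairing_smult r_orth orth)
    moreover have "pairing ?h ?h > 0" using h hk k by (intro pairing_pos) auto
    ultimately show False by simp
  qed
  then have r: "r = smult c p" by simp
  have "pairing p p > 0" using pairing_pos p k by simp
  then have "poly r 1 \<noteq> 0"
    using pairing_convolution[of p p] p k by (auto simp: r_def)
  then have c: "c \<noteq> 0" using r by auto
  \<comment> \<open>As \<open>p\<close> convolved with itself is \<open>c\<close> times
    \<open>p\<close>, dividing by \<open>c\<close> makes it idempotent.\<close>
  define G where "G = smult (1 / c) p"
  have G: "degree G = k" "G \<noteq> 0" using p c by (simp_all add: G_def)
  \<comment> \<open>\<open>convolution\<close> is obtained by choice, so its homogeneity has to be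
    derived by comparing values at pairs of unit vectors.\<close>
  have smult: "convolution G f = smult (1 / c) (convolution p f)" if "degree f \<le> k" for f
  proof (rule zonal_poly_eqI)
    show "degree (convolution G f) \<le> K" "degree (smult (1 / c) (convolution p f)) \<le> K"
      using degree_convolution[of G f] degree_convolution[of p f] that k by auto
    fix x y :: "real ^ 'd" assume xy: "norm x = 1" "norm y = 1"
    have "real (card Z) * poly (convolution G f) (x \<bullet> y) = (\<Sum>z\<in>Z. poly G (x \<bullet> z) * poly f (z \<bullet> y))"
      using sum_convolution[OF Z, of G f x y] xy that k KT G by simp
    also have "\<dots> = 1 / c * (\<Sum>z\<in>Z. poly p (x \<bullet> z) * poly f (z \<bullet> y))"
      by (simp add: G_def sum_distrib_left mult.assoc sum_divide_distrib)
    also have "\<dots> = real (card Z) * (1 / c * poly (convolution p f) (x \<bullet> y))"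
      using sum_convolution[OF Z, of p f x y] xy that k KT p by simp
    finally have "poly (convolution G f) (x \<bullet> y) = 1 / c * poly (convolution p f) (x \<bullet> y)"
      using card_Z by (subst (asm) mult_cancel_left) simp
    then show "poly (convolution G f) (x \<bullet> y) = poly (smult (1 / c) (convolution p f)) (x \<bullet> y)"
      by simp
  qed
  have "convolution p G = p"
  proof (rule zonal_poly_eqI)
    show "degree (convolution p G) \<le> K" "degree p \<le> K"
      using degree_convolution[of p G] p k by auto
    fix x y :: "real ^ 'd" assume xy: "norm x = 1" "norm y = 1"
    have "real (card Z) * poly (convolution p G) (x \<bullet> y) = (\<Sum>z\<in>Z. poly p (x \<bullet> z) * poly G (z \<bullet> y))"
      using sum_convolution[OF Z, of p G x y] xy p k KT G by simp
    also have "\<dots> = 1 / c * (\<Sum>z\<in>Z. poly p (x \<bullet> z) * poly p (z \<bullet> y))"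
      by (simp add: G_def sum_distrib_left mult.assoc sum_divide_distrib)
    also have "\<dots> = 1 / c * (real (card Z) * poly r (x \<bullet> y))"
      using sum_convolution[OF Z, of p p x y] xy k KT p by (simp add: r_def)
    finally show "poly (convolution p G) (x \<bullet> y) = poly p (x \<bullet> y)"
      using card_Z c by (simp add: r field_simps)
  qed
  then have "convolution G G = G"
    using smult[of G] G by (simp add: G_def)
  moreover have "convolution G f = 0" if "degree f < k" for f
    using smult[of f] conv0[OF that] that by simp
  ultimately show ?thesis using G by blast
qed

text \<open>Idempotency fixes the scale: it is that of the reproducing kernel of the spherical
  harmonics of degree \<open>k\<close>, whose value at 1 is their dimension.\<close>

definition gegenbauer :: "nat \<Rightarrow> real poly" where
  "gegenbauer k = (SOME G. degree G = k \<and> G \<noteq> 0 \<and> convolution G G = G \<and>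
     (\<forall>f. degree f < k \<longrightarrow> convolution G f = 0))"

lemma gegenbauer:
  assumes "k \<le> K"
  shows degree_gegenbauer: "degree (gegenbauer k) = k"
    and gegenbauer_nonzero: "gegenbauer k \<noteq> 0"
    and gegenbauer_idem: "convolution (gegenbauer k) (gegenbauer k) = gegenbauer k"
    and gegenbauer_orthogonal: "\<And>f. degree f < k \<Longrightarrow> convolution (gegenbauer k) f = 0"
  using someI_ex[OF convolution_idempotent_exists[OF assms]] unfolding gegenbauer_def by auto

lemma sum_gegenbauer_gegenbauer:
  fixes x y :: "real ^ 'd"
  assumes k: "k \<le> K" and l: "l \<le> K" and Y: "power_moments m t Y" and t: "k + l \<le> t"
    and x: "norm x = 1" and y: "norm y = 1"
  shows "(\<Sum>z\<in>Y. poly (gegenbauer k) (x \<bullet> z) * poly (gegenbauer l) (z \<bullet> y)) =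
    (if k = l then real (card Y) * poly (gegenbauer k) (x \<bullet> y) else 0)"
proof -
  consider "k = l" | "l < k" | "k < l" by linarith
  then show ?thesis
  proof cases
    \<comment> \<open>Orthogonality is available with the polynomial of higher degree on the left,
      so the sum is read from \<open>y\<close> to \<open>x\<close>.\<close>
    case 3
    have "(\<Sum>z\<in>Y. poly (gegenbauer k) (x \<bullet> z) * poly (gegenbauer l) (z \<bullet> y))
      = (\<Sum>z\<in>Y. poly (gegenbauer l) (y \<bullet> z) * poly (gegenbauer k) (z \<bullet> x))"
      by (simp add: inner_commute mult.commute)
    also have "\<dots> = 0"
      using sum_convolution[OF Y, of "gegenbauer l" "gegenbauer k" y x] assms 3
      by (simp add: degree_gegenbauer gegenbauer_orthogonal add.commute)
    finally show ?thesis using 3 by simp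
  qed (use sum_convolution[OF Y, of "gegenbauer k" "gegenbauer l" x y] assms in
      \<open>auto simp: degree_gegenbauer gegenbauer_idem gegenbauer_orthogonal\<close>)
qed

lemma gegenbauer_0: "gegenbauer 0 = 1"
proof -
  obtain a where a: "gegenbauer 0 = [:a:]"
    using degree_gegenbauer[of 0] by (auto elim: degree_eq_zeroE)
  have "a \<noteq> 0" using gegenbauer_nonzero[of 0] a by auto
  moreover have "real (card Z) * (a * a) = real (card Z) * a"
    using sum_gegenbauer_gegenbauer[OF _ _ Z, of 0 0 pole pole] norm_pole by (simp add: a)
  ultimately show ?thesis using card_Z by (simp add: a one_pCons)
qed

text \<open>Convolving \<open>?G\<close> with its reflection \<open>?N\<close> gives
  \<open>?N\<close> back (replace \<open>y\<close> by \<open>- y\<close>), so the convolution of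
  \<open>?G\<close> with \<open>H\<close> is \<open>H\<close>. But the leading terms in
  \<open>H\<close> cancel, and for positive \<open>k\<close> convolution with \<open>?G\<close>
  annihilates lower degrees.\<close>

lemma gegenbauer_parity:
  assumes k: "k \<le> K"
  shows "poly (gegenbauer k) (- u) = (-1) ^ k * poly (gegenbauer k) u"
proof -
  let ?G = "gegenbauer k"
  let ?N = "pcompose ?G [:0, -1:]"
  define H where "H = ?N - smult ((-1) ^ k) ?G"
  have G: "degree ?G = k" using k by (rule degree_gegenbauer)
  have deg: "degree H \<le> k"
    unfolding H_def using G by (intro degree_diff_le) (auto simp: degree_pcompose)
  have "coeff ?N k = (-1) ^ k * coeff ?G k"
    using lead_coeff_comp[of "[:0, -1:]" ?G] G by (simp add: degree_pcompose mult.commute)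
  then have ck: "coeff H k = 0" by (simp add: H_def)
  have "H = 0"
  proof (cases "k = 0")
    case True
    then show ?thesis using deg ck by (metis leading_coeff_0_iff le_zero_eq)
  next
    case False
    then have H: "degree H < k"
      using deg ck by (metis degree_0 leading_coeff_0_iff nat_less_le bot_nat_0.not_eq_extremum)
    show ?thesis
    proof (rule separating)
      show "degree H \<le> K" using deg k by simp
      fix x y :: "real ^ 'd" assume xy: "norm x = 1" "norm y = 1"
      have "0 = (\<Sum>z\<in>Z. poly ?G (x \<bullet> z) * poly H (z \<bullet> y))"
        using sum_convolution[OF Z, of ?G H x y] G H xy k KT gegenbauer_orthogonal[OF k H] by simp
      also have "\<dots> = (\<Sum>z\<in>Z. poly ?G (x \<bullet> z) * poly ?G (z \<bullet> (- y)))
          - (-1) ^ k * (\<Sum>z\<in>Z. poly ?G (x \<bullet> z) * poly ?G (z \<bullet> y))"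
        by (simp add: H_def poly_pcompose right_diff_distrib sum_subtractf sum_distrib_left
            mult.left_commute)
      also have "\<dots> = real (card Z) * poly H (x \<bullet> y)"
        using sum_gegenbauer_gegenbauer[OF k k Z, of x "- y"] sum_gegenbauer_gegenbauer[OF k k Z,
            of x y] xy KT k
        by (simp add: H_def poly_pcompose algebra_simps)
      finally show "poly H (x \<bullet> y) = 0" using card_Z by simp
    qed
  qed
  then have "poly H u = 0" by simp
  then show ?thesis by (simp add: H_def poly_pcompose)
qed

end

section \<open>Coherent configurations from polynomial kernels\<close>

lemma poly_interpolation_exists:
  fixes f :: "'a::field \<Rightarrow> 'a"
  assumes "finite A"
  shows "\<exists>p. (card A = 0 \<and> p = 0 \<or> degree p < card A) \<and> (\<forall>u\<in>A. poly p u = f u)"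
  using assms
proof (induction A rule: finite_induct)
  case (insert a A)
  then obtain p where p: "card A = 0 \<and> p = 0 \<or> degree p < card A" "\<forall>u\<in>A. poly p u = f u"
    by blast
  define w where "w = (\<Prod>b\<in>A. [:- b, 1:])"
  have w: "degree w = card A" "\<And>u. poly w u = (\<Prod>b\<in>A. u - b)"
    by (simp_all add: w_def degree_prod_eq_sum_degree poly_prod)
  have wa: "poly w a \<noteq> 0"
    using insert by (simp add: w(2))
  let ?q = "p + smult ((f a - poly p a) / poly w a) w"
  have "degree ?q \<le> card A"
    using p(1) w(1) degree_smult_le[of "(f a - poly p a) / poly w a" w]
    by (intro degree_add_le) auto
  moreover have "poly ?q u = f u" if "u \<in> insert a A" for u
  proof (cases "u = a")
    case True
    then show ?thesis using wa by simp
  next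
    case False
    then have "poly w u = 0" using that insert.hyps by (simp add: w(2))
    then show ?thesis using False that p(2) by simp
  qed
  ultimately show ?case
    using insert.hyps by (intro exI[of _ ?q]) auto
qed simp

lemma poly_triangular_independent:
  fixes g :: "nat \<Rightarrow> 'a::field poly"
  assumes "\<And>l. l < N \<Longrightarrow> degree (g l) = l \<and> g l \<noteq> 0" "(\<Sum>l<N. smult (c l) (g l)) = 0" "l < N"
  shows "c l = 0"
  using assms
proof (induction N)
  case (Suc N)
  have "coeff (\<Sum>l<N. smult (c l) (g l)) N = 0"
    unfolding coeff_sum using Suc.prems(1)
    by (intro sum.neutral) (auto intro!: coeff_eq_0)
  then have "c N * coeff (g N) N = 0"
    using arg_cong[OF Suc.prems(2), of "\<lambda>p. coeff p N"] by simp
  moreover have "coeff (g N) N \<noteq> 0"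
    using Suc.prems(1)[of N] by (metis leading_coeff_0_iff lessI)
  ultimately have "c N = 0" by simp
  then show ?case
    using Suc by (cases "l = N") auto
qed simp

lemma poly_vanishing_eq_0:
  fixes p :: "'a::idom poly"
  assumes "degree p < card A" "\<And>u. u \<in> A \<Longrightarrow> poly p u = 0"
  shows "p = 0"
proof (rule ccontr)
  assume p: "p \<noteq> 0"
  have "card A \<le> card {u. poly p u = 0}"
    using assms(2) poly_roots_finite[OF p] by (intro card_mono) auto
  with card_poly_roots_bound[OF p] assms(1) show False by simp
qed

lemma sum_matrix_apply: "(\<Sum>i\<in>I. (M i :: 'a \<Rightarrow> 'b \<Rightarrow> real)) x y = (\<Sum>i\<in>I. M i x y)"
  by (induction I rule: infinite_finite_induct) auto

text \<open>\<open>is_basis\<close> demands injectivity besides independence of the image. Both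
  follow from independence of the family: a collision of \<open>B i\<close> and \<open>B j\<close>
  is a relation with coefficients 1 and -1.\<close>

lemma matrices_independent_family:
  assumes I: "finite I"
    and B: "\<And>c i. (\<And>x y. (\<Sum>i\<in>I. c i * B i x y) = 0) \<Longrightarrow> i \<in> I \<Longrightarrow> c i = 0"
  shows "inj_on B I" "\<not> matrices.dependent (B ` I)"
proof -
  show inj: "inj_on B I"
  proof (rule inj_onI, rule ccontr)
    fix i j assume ij: "i \<in> I" "j \<in> I" "B i = B j" "i \<noteq> j"
    let ?c = "\<lambda>k. if k = i then 1 else if k = j then - 1 else 0 :: real"
    have "(\<Sum>k\<in>I. ?c k * B k x y) = (\<Sum>k\<in>I. (if k = i then B i x y else 0) -
        (if k = j then B j x y else 0))" for x y
      using ij(4) by (intro sum.cong) auto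
    then have "(\<Sum>k\<in>I. ?c k * B k x y) = 0" for x y
      using I ij by (simp add: sum_subtractf)
    then have "?c i = 0" using B[of ?c i] ij(1) by blast
    then show False by simp
  qed
  show "\<not> matrices.dependent (B ` I)"
  proof (rule matrices.independent_if_scalars_zero)
    fix f M assume eq: "(\<Sum>M\<in>B ` I. (\<lambda>x y. f M * M x y)) = 0" and M: "M \<in> B ` I"
    then obtain i where i: "i \<in> I" "M = B i" by blast
    have "(\<Sum>i\<in>I. f (B i) * B i x y) = 0" for x y
      using fun_cong[OF fun_cong[OF eq, of x], of y]
      by (simp add: sum_matrix_apply sum.reindex[OF inj])
    then show "f M = 0" using B[of "\<lambda>i. f (B i)"] i by blast
  qed (use I in simp)
qed

lemma mem_span_family:
  assumes "\<And>x y. M x y = (\<Sum>i\<in>I. c i * B i x y)" "\<And>i. i \<in> I \<Longrightarrow> B i \<in> S"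
  shows "M \<in> matrices.span S"
proof -
  have "M = (\<Sum>i\<in>I. (\<lambda>x y. c i * B i x y))"
    by (auto simp: fun_eq_iff sum_matrix_apply assms(1))
  moreover have "(\<Sum>i\<in>I. (\<lambda>x y. c i * B i x y)) \<in> matrices.span S"
    using assms(2) by (intro matrices.span_sum matrices.span_scale matrices.span_base)
  ultimately show ?thesis by simp
qed

text \<open>All that the configuration needs from the designs: in every block one polynomial for
  each degree below the number of its inner products, multiplying like matrix units. On the diagonal
  \<open>ip\<close> contains 1, so \<open>N i j\<close> is the number of relations in the block.
  \<open>N_min\<close> is the part of (B4) saying that the product has an index that exists in the
  outer block.\<close>

locale kernel_system =
  fixes I :: "nat set" and X :: "nat \<Rightarrow> (real ^ 'd) set" and g :: "nat \<Rightarrow> nat \<Rightarrow> nat \<Rightarrow> real poly"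
    and ip :: "nat \<Rightarrow> nat \<Rightarrow> real set" and N :: "nat \<Rightarrow> nat \<Rightarrow> nat"
  defines "ip \<equiv> \<lambda>i j. {x \<bullet> y | x y. x \<in> X i \<and> y \<in> X j}"
    and "N \<equiv> \<lambda>i j. card (ip i j)"
  assumes finite_I: "finite I"
    and X: "\<And>i. i \<in> I \<Longrightarrow> finite (X i)" "\<And>i. i \<in> I \<Longrightarrow> X i \<noteq> {}"
      "\<And>i x. i \<in> I \<Longrightarrow> x \<in> X i \<Longrightarrow> norm x = 1"
    and disjoint: "\<And>i j x. i \<in> I \<Longrightarrow> j \<in> I \<Longrightarrow> x \<in> X i \<Longrightarrow> x \<in> X j \<Longrightarrow> i = j"
    and degree_g: "\<And>i j l. i \<in> I \<Longrightarrow> j \<in> I \<Longrightarrow> l < N i j \<Longrightarrow> degree (g i j l) = l"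
    and g_0: "\<And>i j. i \<in> I \<Longrightarrow> j \<in> I \<Longrightarrow> g i j 0 = 1"
    and g_commute: "\<And>i j l. i \<in> I \<Longrightarrow> j \<in> I \<Longrightarrow> g i j l = g j i l"
    and g_convolution: "\<And>i j h l k x y. i \<in> I \<Longrightarrow> j \<in> I \<Longrightarrow> h \<in> I \<Longrightarrow> l < N i j \<Longrightarrow> k < N j h \<Longrightarrow>
      x \<in> X i \<Longrightarrow> y \<in> X h \<Longrightarrow> (\<Sum>z\<in>X j. poly (g i j l) (x \<bullet> z) * poly (g j h k) (z \<bullet> y)) =
        (if l = k then real (card (X j)) * poly (g i h l) (x \<bullet> y) else 0)"
    and N_min: "\<And>i j h l. i \<in> I \<Longrightarrow> j \<in> I \<Longrightarrow> h \<in> I \<Longrightarrow> l < N i j \<Longrightarrow> l < N j h \<Longrightarrow> l < N i h"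
begin

section \<open>The relations form a coherent configuration\<close>

definition rel :: "nat \<Rightarrow> nat \<Rightarrow> real \<Rightarrow> ((real ^ 'd) \<times> (real ^ 'd)) set" where
  "rel i j \<alpha> = {(x, y). x \<in> X i \<and> y \<in> X j \<and> x \<bullet> y = \<alpha>}"

text \<open>The index set is a parameter so that \<open>I\<close> gives the whole configuration and
  a singleton gives the scheme on one fiber.\<close>

definition rels :: "nat set \<Rightarrow> ((real ^ 'd) \<times> (real ^ 'd)) set set" where
  "rels J = {rel i j \<alpha> | i j \<alpha>. i \<in> J \<and> j \<in> J \<and> \<alpha> \<in> ip i j}"

lemma finite_ip: "i \<in> I \<Longrightarrow> j \<in> I \<Longrightarrow> finite (ip i j)"
  unfolding ip_def using X(1) by (intro finite_image_set2) simp_all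

lemma N_pos:
  assumes "i \<in> I" "j \<in> I"
  shows "0 < N i j"
proof -
  have "ip i j \<noteq> {}" using X(2)[OF assms(1)] X(2)[OF assms(2)] unfolding ip_def by blast
  with finite_ip[OF assms] show ?thesis by (simp add: N_def card_gt_0_iff)
qed

lemma g_nonzero: "i \<in> I \<Longrightarrow> j \<in> I \<Longrightarrow> l < N i j \<Longrightarrow> g i j l \<noteq> 0"
  using degree_g[of i j l] g_0[of i j] by (cases "l = 0") auto

lemma kernel_expansion:
  assumes "i \<in> I" "j \<in> I"
  obtains c where "\<And>u. u \<in> ip i j \<Longrightarrow> f u = (\<Sum>l<N i j. c l * poly (g i j l) u)"
proof -
  obtain p where p: "card (ip i j) = 0 \<and> p = 0 \<or> degree p < card (ip i j)" "\<forall>u\<in>ip i j. poly p u = f u"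
    using poly_interpolation_exists[OF finite_ip[OF assms]] by blast
  then obtain c where "p = (\<Sum>l<N i j. smult (c l) (g i j l))"
    using poly_triangular_expansion[of "N i j" "g i j" p] degree_g g_nonzero assms unfolding N_def
        by blast
  with p(2) show ?thesis
    by (intro that[of c]) (auto simp: poly_sum)
qed

lemma kernel_independent:
  assumes "i \<in> I" "j \<in> I" "\<And>u. u \<in> ip i j \<Longrightarrow> (\<Sum>l<N i j. c l * poly (g i j l) u) = 0" "l < N i j"
  shows "c l = 0"
proof -
  let ?p = "\<Sum>l<N i j. smult (c l) (g i j l)"
  have "degree ?p \<le> N i j - 1"
    using degree_g assms by (intro degree_sum_le) (auto intro!: order_trans[OF degree_smult_le])
  then have "?p = 0"
    using N_pos[OF assms(1,2)] assms(3)
    by (intro poly_vanishing_eq_0[of _ "ip i j"]) (auto simp: N_def poly_sum)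
  then show ?thesis
    using poly_triangular_independent[of "N i j" "g i j" c l] degree_g g_nonzero assms by blast
qed

lemma rel_eq_iff: "(x, y) \<in> rel i j \<alpha> \<longleftrightarrow> x \<in> X i \<and> y \<in> X j \<and> x \<bullet> y = \<alpha>"
  by (simp add: rel_def)

lemma rel_nonempty: "\<alpha> \<in> ip i j \<Longrightarrow> rel i j \<alpha> \<noteq> {}"
  by (auto simp: ip_def rel_def)

lemma rel_inj:
  assumes "i \<in> I" "j \<in> I" "i' \<in> I" "j' \<in> I" "(x, y) \<in> rel i j \<alpha>" "(x, y) \<in> rel i' j' \<beta>"
  shows "i = i' \<and> j = j' \<and> \<alpha> = \<beta>"
  using assms disjoint unfolding rel_eq_iff by blast

lemma inner_eq_1: "i \<in> I \<Longrightarrow> j \<in> I \<Longrightarrow> x \<in> X i \<Longrightarrow> y \<in> X j \<Longrightarrow> x \<bullet> y = 1 \<longleftrightarrow> x = y"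
  using X(3) by (intro unit_inner_eq_1_iff)

lemma rel_diagonal: "i \<in> I \<Longrightarrow> rel i i 1 = Id_on (X i)" "i \<in> I \<Longrightarrow> 1 \<in> ip i i"
proof -
  assume i: "i \<in> I"
  then show "rel i i 1 = Id_on (X i)" by (auto simp: rel_def inner_eq_1[OF i i])
  obtain x where "x \<in> X i" using X(2)[OF i] by blast
  then have "x \<bullet> x = 1" "x \<in> X i" using X(3)[OF i] by (simp_all add: dot_square_norm)
  then show "1 \<in> ip i i" unfolding ip_def by force
qed

text \<open>The indicators of \<alpha> and \<beta> are expanded in kernels. Summing their product
  over the middle design leaves a combination of the kernels \<open>g i h l\<close>, and these
  depend on \<open>x\<close> and \<open>y\<close> only through
  \<open>x \<bullet> y = \<gamma>\<close>.\<close>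

lemma intersection_numbers:
  assumes "i \<in> I" "j \<in> I" "j' \<in> I" "h \<in> I" "i' \<in> I" "h' \<in> I" "\<alpha> \<in> ip i j" "\<beta> \<in> ip j' h"
  shows "\<exists>p. \<forall>(x, y)\<in>rel i' h' \<gamma>. card {z. (x, z) \<in> rel i j \<alpha> \<and> (z, y) \<in> rel j' h \<beta>} = p"
proof (cases "i = i' \<and> j = j' \<and> h = h'")
  case False
  have "card {z. (x, z) \<in> rel i j \<alpha> \<and> (z, y) \<in> rel j' h \<beta>} = 0" if "(x, y) \<in> rel i' h' \<gamma>" for x y
  proof -
    have "{z. (x, z) \<in> rel i j \<alpha> \<and> (z, y) \<in> rel j' h \<beta>} = {}"
      using False that disjoint assms unfolding rel_eq_iff by blast
    then show ?thesis by (simp only: card.empty)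
  qed
  then show ?thesis by blast
next
  case True
  obtain c where c: "\<And>u. u \<in> ip i j \<Longrightarrow> of_bool (u = \<alpha>) = (\<Sum>l<N i j. c l * poly (g i j l) u)"
    using kernel_expansion[OF assms(1,2), of "\<lambda>u. of_bool (u = \<alpha>)"] by blast
  obtain d where d: "\<And>u. u \<in> ip j h \<Longrightarrow> of_bool (u = \<beta>) = (\<Sum>k<N j h. d k * poly (g j h k) u)"
    using kernel_expansion[OF assms(2,4), of "\<lambda>u. of_bool (u = \<beta>)"] by blast
  define q where "q = (\<Sum>l<N i j. \<Sum>k<N j h. c l * d k *
      (if l = k then real (card (X j)) * poly (g i h l) \<gamma> else 0))"
  have count: "real (card {z. (x, z) \<in> rel i j \<alpha> \<and> (z, y) \<in> rel j' h \<beta>})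
      = q" if xy: "(x, y) \<in> rel i' h' \<gamma>" for x y
  proof -
    have x: "x \<in> X i" "y \<in> X h" "x \<bullet> y = \<gamma>" using xy True by (auto simp: rel_eq_iff)
    have "{z. (x, z) \<in> rel i j \<alpha> \<and> (z, y) \<in> rel j' h \<beta>} = {z \<in> X j. x \<bullet> z = \<alpha> \<and> z \<bullet> y = \<beta>}"
      using x True by (auto simp: rel_eq_iff)
    then have "real (card {z. (x, z) \<in> rel i j \<alpha> \<and> (z, y) \<in> rel j' h \<beta>})
        = (\<Sum>z\<in>X j. of_bool (x \<bullet> z = \<alpha>) * of_bool (z \<bullet> y = \<beta>))"
      using X(1)[OF assms(2)] by (simp add: Int_def flip: of_bool_conj)
    also have "\<dots> = (\<Sum>z\<in>X j. (\<Sum>l<N i j. c l * poly (g i j l) (x \<bullet> z))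
        * (\<Sum>k<N j h. d k * poly (g j h k) (z \<bullet> y)))"
    proof (intro sum.cong refl)
      fix z assume "z \<in> X j"
      then have "x \<bullet> z \<in> ip i j" "z \<bullet> y \<in> ip j h" using x by (auto simp: ip_def)
      then show "of_bool (x \<bullet> z = \<alpha>) * of_bool (z \<bullet> y = \<beta>) =
        (\<Sum>l<N i j. c l * poly (g i j l) (x \<bullet> z)) * (\<Sum>k<N j h. d k * poly (g j h k) (z \<bullet> y))"
        by (simp only: c d)
    qed
    also have "\<dots> = (\<Sum>z\<in>X j. \<Sum>l<N i j. \<Sum>k<N j h. c l * d k
        * (poly (g i j l) (x \<bullet> z) * poly (g j h k) (z \<bullet> y)))"
      by (simp add: sum_product mult_ac)
    also have "\<dots> = (\<Sum>l<N i j. \<Sum>k<N j h. c l * d k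
        * (\<Sum>z\<in>X j. poly (g i j l) (x \<bullet> z) * poly (g j h k) (z \<bullet> y)))"
      by (simp add: sum_distrib_left sum.swap[of _ "X j"])
    also have "\<dots> = q"
      unfolding q_def using assms x by (intro sum.cong refl) (simp add: g_convolution)
    finally show ?thesis .
  qed
  \<comment> \<open>\<open>q\<close> is a real expression in the coefficients;
    \<open>nat \<lfloor>q\<rfloor>\<close> makes it a natural number that is fixed before
    \<open>x\<close> and \<open>y\<close>.\<close>
  have card: "card {z. (x, z) \<in> rel i j \<alpha> \<and> (z, y) \<in> rel j' h \<beta>} = nat \<lfloor>q\<rfloor>"
    if "(x, y) \<in> rel i' h' \<gamma>" for x y
    using arg_cong[OF count[OF that], of "\<lambda>r. nat \<lfloor>r\<rfloor>"] by (simp only: floor_of_nat nat_int)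
  show ?thesis
  proof (intro exI[of _ "nat \<lfloor>q\<rfloor>"] ballI)
    fix w assume "w \<in> rel i' h' \<gamma>"
    then have "(fst w, snd w) \<in> rel i' h' \<gamma>" by simp
    from card[OF this] show "case w of (x, y) \<Rightarrow> card {z. (x, z) \<in> rel i j \<alpha> \<and> (z, y) \<in> rel j' h \<beta>}
        = nat \<lfloor>q\<rfloor>"
      by (simp only: case_prod_beta)
  qed
qed

lemma coherent_configuration_rels:
  assumes J: "J \<subseteq> I"
  shows "coherent_configuration (\<Union>i\<in>J. X i) (rels J)"
  unfolding coherent_configuration_def
proof (intro conjI ballI impI)
  let ?Y = "\<Union>i\<in>J. X i"
  show "finite ?Y"
    using finite_subset[OF J finite_I] X(1) J by auto
  show "partition_on (?Y \<times> ?Y) (rels J)"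
  proof (rule partition_onI)
    show "\<Union> (rels J) = ?Y \<times> ?Y"
      unfolding rels_def rel_def ip_def by blast
    fix R R' assume "R \<in> rels J" "R' \<in> rels J" "R \<noteq> R'"
    then obtain i j \<alpha> i' j' \<alpha>' where R: "R = rel i j \<alpha>" "R' = rel i' j' \<alpha>'"
        and ij: "i \<in> I" "j \<in> I" "i' \<in> I" "j' \<in> I"
      using J unfolding rels_def by blast
    show "disjnt R R'"
    proof (rule ccontr)
      assume "\<not> disjnt R R'"
      then obtain x y where "(x, y) \<in> R" "(x, y) \<in> R'" by (auto simp: disjnt_def)
      then show False using rel_inj ij R \<open>R \<noteq> R'\<close> by blast
    qed
  next
    show "{} \<notin> rels J"
      using rel_nonempty unfolding rels_def by blast
  qed
  fix R assume "R \<in> rels J"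
  then obtain i j \<alpha> where R: "R = rel i j \<alpha>" and ij: "i \<in> J" "j \<in> J" "\<alpha> \<in> ip i j"
    unfolding rels_def by blast
  have "R\<inverse> = rel j i \<alpha>" by (auto simp: R rel_def inner_commute)
  moreover have "\<alpha> \<in> ip j i" using ij(3) unfolding ip_def by (auto, metis inner_commute)
  ultimately show "R\<inverse> \<in> rels J" using ij unfolding rels_def by blast
  show "R \<subseteq> Id_on ?Y" if diag: "R \<inter> Id_on ?Y \<noteq> {}"
  proof -
    obtain x where x: "(x, x) \<in> R" using diag by (auto simp: Id_on_def)
    then have "i = j" using R ij J disjoint[of i j x] by (auto simp: rel_eq_iff)
    moreover have "\<alpha> = 1" using x R ij J X(3)[of i x] by (auto simp: rel_eq_iff dot_square_norm)
    ultimately have "R = Id_on (X i)" using R rel_diagonal(1)[of i] ij J by auto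
    then show ?thesis using ij by auto
  qed
  fix R' R'' assume "R' \<in> rels J" "R'' \<in> rels J"
  then obtain j' h \<beta> i' h' \<gamma> where R': "R' = rel j' h \<beta>"
      "R'' = rel i' h' \<gamma>" "j' \<in> J" "h \<in> J" "i' \<in> J" "h' \<in> J"
      "\<beta> \<in> ip j' h"
    unfolding rels_def by blast
  then show "\<exists>p. \<forall>(x, y)\<in>R''. card {z. (x, z) \<in> R \<and> (z, y) \<in> R'} = p"
    using intersection_numbers[of i j j' h i' h' \<alpha> \<beta> \<gamma>] R ij J by blast
qed

lemma fibers_rels: "fibers (rels I) = X ` I"
proof (intro equalityI subsetI)
  fix F assume "F \<in> fibers (rels I)"
  then obtain i j \<alpha> where F: "Id_on F = rel i j \<alpha>" "i \<in> I" "j \<in> I" "\<alpha> \<in> ip i j"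
    unfolding fibers_def rels_def by blast
  then obtain x where x: "(x, x) \<in> rel i j \<alpha>"
    using rel_nonempty by (metis Id_onE ex_in_conv)
  then have "i = j" using F disjoint by (auto simp: rel_eq_iff)
  moreover have "\<alpha> = 1" using x F X(3) by (auto simp: rel_eq_iff dot_square_norm)
  ultimately have "Id_on F = Id_on (X i)" using F rel_diagonal(1)[of i] by auto
  then show "F \<in> X ` I" using F(2) by (metis Domain_Id_on image_eqI)
next
  fix F assume "F \<in> X ` I"
  then show "F \<in> fibers (rels I)"
    using rel_diagonal unfolding fibers_def rels_def by fastforce
qed

lemma relations_between_rels:
  assumes "i \<in> I" "j \<in> I"
  shows "relations_between (rels I) (X i) (X j) = rel i j ` ip i j"
proof (intro equalityI subsetI)
  fix R assume "R \<in> relations_between (rels I) (X i) (X j)"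
  then obtain i' j' \<alpha> where R: "R = rel i' j' \<alpha>" "i' \<in> I" "j' \<in> I" "\<alpha> \<in> ip i' j'" "R \<subseteq> X i \<times> X j"
    unfolding relations_between_def rels_def by blast
  then obtain x y where "(x, y) \<in> R" using rel_nonempty by (metis ex_in_conv surj_pair)
  then have "i' = i \<and> j' = j" using R disjoint assms unfolding rel_def by blast
  then show "R \<in> rel i j ` ip i j" using R by blast
next
  fix R assume "R \<in> rel i j ` ip i j"
  then show "R \<in> relations_between (rels I) (X i) (X j)"
    using assms unfolding relations_between_def rels_def rel_def by blast
qed

lemma le_rtilde_iff:
  assumes "i \<in> I" "j \<in> I"
  shows "l \<le> rtilde (rels I) (X i) (X j) \<longleftrightarrow> l < N i j"
proof -
  have "inj_on (rel i j) (ip i j)"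
  proof (rule inj_onI)
    fix \<alpha> \<beta> assume "\<alpha> \<in> ip i j" "rel i j \<alpha> = rel i j \<beta>"
    then show "\<alpha> = \<beta>" using rel_nonempty[of \<alpha> i j] by (auto simp: rel_def)
  qed
  then have "card (relations_between (rels I) (X i) (X j)) = N i j"
    by (simp add: relations_between_rels[OF assms] card_image N_def)
  then show ?thesis
    using N_pos[OF assms] by (auto simp: rtilde_def)
qed

lemma symmetric_association_scheme_fiber:
  assumes i: "i \<in> I"
  shows "symmetric_association_scheme (X i) (relations_between (rels I) (X i) (X i))"
proof -
  have "rels {i} = rel i i ` ip i i" unfolding rels_def by blast
  then have "coherent_configuration (X i) (rel i i ` ip i i)"
    using coherent_configuration_rels[of "{i}"] i by simp
  moreover have "(rel i i \<alpha>)\<inverse> = rel i i \<alpha>" for \<alpha>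
    by (auto simp: rel_def inner_commute)
  moreover have "Id_on (X i) \<in> rel i i ` ip i i"
    using rel_diagonal[OF i] by (metis image_eqI)
  ultimately show ?thesis
    by (auto simp: symmetric_association_scheme_def relations_between_rels[OF i i])
qed

section \<open>The idempotents and the block basis\<close>

definition idempotent :: "nat \<Rightarrow> nat \<Rightarrow> nat \<Rightarrow> real ^ 'd \<Rightarrow> real ^ 'd \<Rightarrow> real" where
  "idempotent i j l x y = (if x \<in> X i \<and> y \<in> X j
     then poly (g i j l) (x \<bullet> y) / sqrt (real (card (X i)) * real (card (X j))) else 0)"

text \<open>\<open>block_basis\<close> indexes matrices by fibers; since the \<open>X i\<close> are
  nonempty and disjoint, \<open>inv_into\<close> recovers the index.\<close>

definition idempotent_of :: "(real ^ 'd) set \<Rightarrow> (real ^ 'd) set \<Rightarrow> nat \<Rightarrow> real ^ 'd \<Rightarrow> real ^ 'd \<Rightarrow>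
    real" where
  "idempotent_of F G = idempotent (inv_into I X F) (inv_into I X G)"

lemma inj_X: "inj_on X I"
  using X(2) disjoint by (metis all_not_in_conv inj_onI)

lemma idempotent_of [simp]: "i \<in> I \<Longrightarrow> j \<in> I \<Longrightarrow> idempotent_of (X i) (X j) = idempotent i j"
  by (simp add: idempotent_of_def inj_X)

lemma card_X_pos: "i \<in> I \<Longrightarrow> 0 < real (card (X i))"
  using X by (simp add: card_gt_0_iff)

lemma sqrt_card_pos: "i \<in> I \<Longrightarrow> j \<in> I \<Longrightarrow> 0 < sqrt (real (card (X i)) * real (card (X j)))"
  using card_X_pos by simp

lemma idempotent_0:
  assumes "i \<in> I" "j \<in> I"
  shows "idempotent i j 0 = matrix_smult (1 / sqrt (real (card (X i)) * real (card (X j))))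
      (all_ones (X i) (X j))"
  by (auto simp: fun_eq_iff idempotent_def matrix_smult_def all_ones_def g_0[OF assms])

lemma idempotent_transpose: "i \<in> I \<Longrightarrow> j \<in> I \<Longrightarrow> matrix_transpose (idempotent i j l) = idempotent j i l"
  by (auto simp: fun_eq_iff idempotent_def matrix_transpose_def inner_commute mult.commute
      g_commute[of i j])

lemma idempotent_prod:
  assumes "i \<in> I" "j \<in> I" "j' \<in> I" "h \<in> I" "l < N i j" "k < N j' h"
  shows "matrix_prod (\<Union>i\<in>I. X i) (idempotent i j l) (idempotent j' h k) =
    (if l = k \<and> j = j' then idempotent i h l else 0)"
proof (intro ext)
  fix x y
  let ?s = "\<lambda>i j. sqrt (real (card (X i)) * real (card (X j)))"
  have "matrix_prod (\<Union>i\<in>I. X i) (idempotent i j l) (idempotent j' h k) x y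
    = (\<Sum>z\<in>X j. idempotent i j l x z * idempotent j' h k z y)"
    unfolding matrix_prod_def using finite_I X(1) assms
    by (intro sum.mono_neutral_right) (auto simp: idempotent_def)
  also have "\<dots> = (if l = k \<and> j = j' then idempotent i h l else 0) x y"
  proof (cases "j = j' \<and> x \<in> X i \<and> y \<in> X h")
    case True
    then have "(\<Sum>z\<in>X j. idempotent i j l x z * idempotent j' h k z y)
      = (\<Sum>z\<in>X j. poly (g i j l) (x \<bullet> z) * poly (g j h k) (z \<bullet> y)) / (?s i j * ?s j h)"
      by (auto simp: idempotent_def sum_divide_distrib intro!: sum.cong)
    also have "\<dots> = (if l = k then real (card (X j)) * poly (g i h l) (x \<bullet> y) else 0) /
        (?s i j * ?s j h)"
      using g_convolution[of i j h l k x y] True assms by simp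
    \<comment> \<open>The convolution contributes a factor \<open>card (X j)\<close>. Scaling each
      block by the root of the product of both sizes makes exactly this factor cancel.\<close>
    also have "?s i j * ?s j h = real (card (X j)) * ?s i h"
      by (simp add: real_sqrt_mult)
    finally show ?thesis
      using True card_X_pos[of j] assms by (simp add: idempotent_def)
  next
    case False
    have "(\<Sum>z\<in>X j. idempotent i j l x z * idempotent j' h k z y) = 0"
      using False disjoint[OF assms(2,3)] by (intro sum.neutral) (auto simp: idempotent_def)
    then show ?thesis using False by (auto simp: idempotent_def)
  qed
  finally show "matrix_prod (\<Union>i\<in>I. X i) (idempotent i j l) (idempotent j' h k) x y
    = (if l = k \<and> j = j' then idempotent i h l else 0) x y" .
qed

lemma idempotent_span:
  assumes "i \<in> I" "j \<in> I"
  shows "idempotent i j l \<in> matrices.span (adjacency ` rel i j ` ip i j)"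
proof (rule mem_span_family[where I = "ip i j" and B = "\<lambda>\<alpha>. adjacency (rel i j \<alpha>)"
      and c = "\<lambda>\<alpha>. poly (g i j l) \<alpha> / sqrt (real (card (X i)) * real (card (X j)))"])
  fix x y
  show "idempotent i j l x y
    = (\<Sum>\<alpha>\<in>ip i j. poly (g i j l) \<alpha> / sqrt (real (card (X i)) * real (card (X j))) * adjacency
        (rel i j \<alpha>) x y)"
  proof (cases "x \<in> X i \<and> y \<in> X j")
    case True
    then have "x \<bullet> y \<in> ip i j" by (auto simp: ip_def)
    then have "idempotent i j l x y
      = (\<Sum>\<alpha>\<in>ip i j. if \<alpha> = x \<bullet> y then poly (g i j l) \<alpha> / sqrt (real (card (X i)) *
          real (card (X j))) else 0)"
      using True finite_ip[OF assms] by (simp add: idempotent_def)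
    also have "\<dots> = (\<Sum>\<alpha>\<in>ip i j. poly (g i j l) \<alpha> / sqrt (real (card (X i)) * real (card (X j))) *
        adjacency (rel i j \<alpha>) x y)"
      using True by (intro sum.cong) (auto simp: adjacency_def rel_eq_iff)
    finally show ?thesis .
  qed (auto simp: idempotent_def adjacency_def rel_eq_iff)
qed auto

lemma adjacency_span:
  assumes "i \<in> I" "j \<in> I"
  shows "adjacency (rel i j \<alpha>) \<in> matrices.span (idempotent i j ` {..<N i j})"
proof -
  let ?s = "sqrt (real (card (X i)) * real (card (X j)))"
  obtain c where c: "\<And>u. u \<in> ip i j \<Longrightarrow> of_bool (u = \<alpha>) = (\<Sum>l<N i j. c l * poly (g i j l) u)"
    using kernel_expansion[OF assms, of "\<lambda>u. of_bool (u = \<alpha>)"] by blast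
  show ?thesis
  proof (rule mem_span_family[where I = "{..<N i j}" and B = "idempotent i j" and c = "\<lambda>l. c l * ?s"])
    fix x y
    show "adjacency (rel i j \<alpha>) x y = (\<Sum>l<N i j. c l * ?s * idempotent i j l x y)"
    proof (cases "x \<in> X i \<and> y \<in> X j")
      case True
      then have "x \<bullet> y \<in> ip i j" by (auto simp: ip_def)
      then show ?thesis
        using True c[of "x \<bullet> y"] card_X_pos[OF assms(1)] card_X_pos[OF assms(2)]
            by (simp add: idempotent_def adjacency_def rel_eq_iff)
    qed (auto simp: idempotent_def adjacency_def rel_eq_iff)
  qed auto
qed

lemma idempotent_independent:
  assumes "i \<in> I" "j \<in> I" "\<And>x y. x \<in> X i \<Longrightarrow> y \<in> X j \<Longrightarrow> (\<Sum>l<N i j. c l * idempotent i j l x y)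
      = 0" "l < N i j"
  shows "c l = 0"
proof (rule kernel_independent[OF assms(1,2) _ assms(4)])
  fix u assume "u \<in> ip i j"
  then obtain x y where xy: "x \<in> X i" "y \<in> X j" "u = x \<bullet> y" by (auto simp: ip_def)
  have "(\<Sum>l<N i j. c l * poly (g i j l) u) / sqrt (real (card (X i)) * real (card (X j)))
      = (\<Sum>l<N i j. c l * idempotent i j l x y)"
    using xy by (simp add: idempotent_def sum_divide_distrib)
  then show "(\<Sum>l<N i j. c l * poly (g i j l) u) = 0"
    using assms(3)[OF xy(1,2)] card_X_pos[OF assms(1)] card_X_pos[OF assms(2)] by simp
qed

lemma is_basis_block:
  assumes "i \<in> I" "j \<in> I"
  shows "is_basis (idempotent i j) {..<N i j} (matrices.span (adjacency ` rel i j ` ip i j))"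
proof -
  have "inj_on (idempotent i j) {..<N i j}" "\<not> matrices.dependent (idempotent i j ` {..<N i j})"
    using matrices_independent_family[of "{..<N i j}" "idempotent i j"] idempotent_independent[OF
        assms] by auto
  moreover have "matrices.span (idempotent i j ` {..<N i j})
      = matrices.span (adjacency ` rel i j ` ip i j)"
    unfolding matrices.span_eq using idempotent_span[OF assms] adjacency_span[OF assms] by auto
  ultimately show ?thesis by (simp add: is_basis_def)
qed

lemma is_basis_total:
  "is_basis (\<lambda>(i, j, l). idempotent i j l) {(i, j, l). i \<in> I \<and> j \<in> I \<and> l < N i j}
     (matrices.span (adjacency ` rels I))"
proof -
  let ?K = "{(i, j, l). i \<in> I \<and> j \<in> I \<and> l < N i j}" and ?B = "\<lambda>(i, j, l). idempotent i j l"
  have K: "?K = Sigma I (\<lambda>i. Sigma I (\<lambda>j. {..<N i j}))" by auto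
  have fin: "finite ?K" unfolding K using finite_I by (intro finite_SigmaI) auto
  have "inj_on ?B ?K" "\<not> matrices.dependent (?B ` ?K)"
  proof -
    have zero: "c k = 0" if c: "\<And>x y. (\<Sum>k\<in>?K. c k * ?B k x y) = 0" and k: "k \<in> ?K" for c k
    proof -
      obtain i j l where ijl: "k = (i, j, l)" "i \<in> I" "j \<in> I" "l < N i j" using k by blast
      have "c (i, j, l) = 0"
      proof (rule idempotent_independent[OF ijl(2,3) _ ijl(4)])
        fix x y assume xy: "x \<in> X i" "y \<in> X j"
        \<comment> \<open>At a point of \<open>X i \<times> X j\<close> the matrices of all other
          blocks vanish, so the relation reduces to one within this block.\<close>
        have "(\<Sum>k\<in>?K. c k * ?B k x y) = (\<Sum>k\<in>(\<lambda>l. (i, j, l)) ` {..<N i j}. c k * ?B k x y)"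
        proof (intro sum.mono_neutral_right fin ballI)
          fix k assume "k \<in> ?K - (\<lambda>l. (i, j, l)) ` {..<N i j}"
          then obtain i' j' l' where k: "k = (i', j', l')" "i' \<in> I" "j' \<in> I" "\<not> (i' = i \<and> j' = j)"
            by auto
          then have "\<not> (x \<in> X i' \<and> y \<in> X j')"
            using xy ijl disjoint by blast
          then show "c k * ?B k x y = 0" by (auto simp: k idempotent_def)
        qed (use ijl in auto)
        also have "\<dots> = (\<Sum>l<N i j. c (i, j, l) * idempotent i j l x y)"
          by (subst sum.reindex) (auto simp: inj_on_def)
        finally show "(\<Sum>l<N i j. c (i, j, l) * idempotent i j l x y) = 0" using c by simp
      qed
      then show ?thesis by (simp add: ijl)
    qed
    then show "inj_on ?B ?K" "\<not> matrices.dependent (?B ` ?K)"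
      using matrices_independent_family[OF fin, of ?B] by blast+
  qed
  moreover have "matrices.span (?B ` ?K) = matrices.span (adjacency ` rels I)"
    unfolding matrices.span_eq
  proof (intro conjI subsetI)
    fix M assume "M \<in> ?B ` ?K"
    then obtain i j l where M: "M = idempotent i j l" "i \<in> I" "j \<in> I" by auto
    have "adjacency ` rel i j ` ip i j \<subseteq> adjacency ` rels I"
      using M unfolding rels_def by blast
    then show "M \<in> matrices.span (adjacency ` rels I)"
      using idempotent_span[OF M(2,3)] M(1) matrices.span_mono by blast
  next
    fix M assume "M \<in> adjacency ` rels I"
    then obtain i j \<alpha> where M: "M = adjacency (rel i j \<alpha>)" "i \<in> I" "j \<in> I"
      unfolding rels_def by blast
    have "idempotent i j ` {..<N i j} \<subseteq> ?B ` ?K"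
      using M by force
    then show "M \<in> matrices.span (?B ` ?K)"
      using adjacency_span[OF M(2,3)] M(1) matrices.span_mono by blast
  qed
  ultimately show ?thesis by (simp add: is_basis_def)
qed

lemma block_basis_rels: "block_basis (\<Union>i\<in>I. X i) (rels I) idempotent_of"
  unfolding block_basis_def fibers_rels
proof (intro conjI)
  let ?K = "{(i, j, l). i \<in> I \<and> j \<in> I \<and> l < N i j}"
    and ?L = "{(F, G, l). F \<in> X ` I \<and> G \<in> X ` I \<and> l \<le> rtilde (rels I) F G}"
  let ?f = "\<lambda>(i, j, l). (X i, X j, l)"
  have L: "?L = ?f ` ?K"
    by (auto simp: le_rtilde_iff image_iff) blast
  have inj: "inj_on ?f ?K"
    using inj_X by (auto simp: inj_on_def)
  have eq: "(\<lambda>(F, G, l). idempotent_of F G l) (?f k) = (\<lambda>(i, j, l). idempotent i j l) k"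
      if "k \<in> ?K" for k
    using that by auto
  have "inj_on ((\<lambda>(F, G, l). idempotent_of F G l) \<circ> ?f) ?K \<longleftrightarrow> inj_on (\<lambda>(i, j, l). idempotent i j l) ?K"
    using eq by (intro inj_on_cong) simp
  then have "inj_on (\<lambda>(F, G, l). idempotent_of F G l) ?L"
    using is_basis_total unfolding L is_basis_def by (intro inj_on_imageI) simp
  moreover have "(\<lambda>(F, G, l). idempotent_of F G l) ` ?L = (\<lambda>(i, j, l). idempotent i j l) ` ?K"
    unfolding L image_image using eq by (intro image_cong) auto
  ultimately show "is_basis (\<lambda>(F, G, l). idempotent_of F G l) ?L (matrices.span (adjacency ` rels I))"
    using is_basis_total by (simp add: is_basis_def)
  show "\<forall>F\<in>X ` I. \<forall>G\<in>X ` I. is_basis (idempotent_of F G) {..rtilde (rels I) F G}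
          (matrices.span (adjacency ` relations_between (rels I) F G))"
  proof (clarify)
    fix i j assume ij: "i \<in> I" "j \<in> I"
    have "{..rtilde (rels I) (X i) (X j)} = {..<N i j}"
      using le_rtilde_iff[OF ij] by auto
    then show "is_basis (idempotent_of (X i) (X j)) {..rtilde (rels I) (X i) (X j)}
          (matrices.span (adjacency ` relations_between (rels I) (X i) (X j)))"
      using is_basis_block[OF ij] ij by (simp add: relations_between_rels)
  qed
  show "\<forall>F\<in>X ` I. \<forall>G\<in>X ` I. \<forall>F'\<in>X ` I. \<forall>G'\<in>X ` I.
      \<forall>l\<le>rtilde (rels I) F G. \<forall>l'\<le>rtilde (rels I) F' G'.
        if l = l' \<and> G = F'
        then l \<le> rtilde (rels I) F G' \<and>
          matrix_prod (\<Union>i\<in>I. X i) (idempotent_of F G l) (idempotent_of F' G' l') = idempotent_of F G' l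
        else matrix_prod (\<Union>i\<in>I. X i) (idempotent_of F G l) (idempotent_of F' G' l') = 0"
  proof (clarify)
    fix i j j' h l l'
    assume ij: "i \<in> I" "j \<in> I" "j' \<in> I" "h \<in> I"
      and "l \<le> rtilde (rels I) (X i) (X j)" "l' \<le> rtilde (rels I) (X j') (X h)"
    then have l: "l < N i j" "l' < N j' h" by (simp_all add: le_rtilde_iff)
    have "X j = X j' \<longleftrightarrow> j = j'" using inj_X ij by (auto simp: inj_on_def)
    then show "if l = l' \<and> X j = X j'
        then l \<le> rtilde (rels I) (X i) (X h) \<and>
          matrix_prod (\<Union>i\<in>I. X i) (idempotent_of (X i) (X j) l) (idempotent_of (X j') (X h) l')
              = idempotent_of (X i) (X h) l
        else matrix_prod (\<Union>i\<in>I. X i) (idempotent_of (X i) (X j) l) (idempotent_of (X j') (X h) l') = 0"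
      using idempotent_prod[OF ij l] N_min[of i j h l] ij l
      by (cases "l = l' \<and> j = j'") (auto simp: le_rtilde_iff)
  qed
qed (auto simp: idempotent_0 idempotent_transpose)

text \<open>\<open>g i j 1\<close> is an affine function \<open>a + b * u\<close>; substituting its
  inverse into \<open>g i j h\<close> gives \<open>v h\<close>. If \<open>N i j = 1\<close>, then
  \<open>b\<close> may be 0, but only the constant \<open>h = 0\<close> occurs.\<close>

lemma kernel_polynomials:
  assumes ij: "i \<in> I" "j \<in> I"
  obtains v :: "nat \<Rightarrow> real poly"
  where "\<And>h. h < N i j \<Longrightarrow> degree (v h) = h" "\<And>h u. h < N i j \<Longrightarrow> poly (v h) (poly (g i j 1) u)
      = poly (g i j h) u"
proof -
  define a b where "a = coeff (g i j 1) 0" and "b = coeff (g i j 1) 1"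
  define v where "v h = pcompose (g i j h) [:- a / b, 1 / b:]" for h
  show ?thesis
  proof (rule that[of v])
    fix h u assume h: "h < N i j"
    have "degree (v h) = h \<and> poly (v h) (poly (g i j 1) u) = poly (g i j h) u"
    proof (cases "h = 0")
      case True
      then show ?thesis by (simp add: v_def g_0[OF ij] pcompose_1)
    next
      case False
      with h have deg: "degree (g i j 1) = 1" using degree_g[OF ij, of 1] by simp
      then have b: "b \<noteq> 0" unfolding b_def by (metis degree_0 leading_coeff_0_iff zero_neq_one)
      have "poly (g i j 1) u = a + b * u"
        using deg by (simp add: poly_altdef a_def b_def)
      then show ?thesis
        using b degree_g[OF ij h] by (simp add: v_def degree_pcompose poly_pcompose field_simps)
    qed
    then show "degree (v h) = h" "poly (v h) (poly (g i j 1) u) = poly (g i j h) u" by auto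
  qed
qed

lemma Q_polynomial_rels: "Q_polynomial_coherent_configuration (\<Union>i\<in>I. X i) (rels I)"
  unfolding Q_polynomial_coherent_configuration_def
proof (intro conjI exI[of _ idempotent_of])
  show "\<forall>F\<in>fibers (rels I). \<forall>G\<in>fibers (rels I). \<exists>v :: nat \<Rightarrow> real poly. \<forall>h\<le>rtilde (rels I) F G.
     degree (v h) = h \<and>
     matrix_smult (sqrt (real (card F) * real (card G))) (idempotent_of F G h) =
       entrywise_poly F G (v h)
         (matrix_smult (sqrt (real (card F) * real (card G))) (idempotent_of F G 1))"
    unfolding fibers_rels
  proof clarify
    fix i j assume ij: "i \<in> I" "j \<in> I"
    obtain v where v: "\<And>h. h < N i j \<Longrightarrow> degree (v h) = h"
        "\<And>h u. h < N i j \<Longrightarrow> poly (v h) (poly (g i j 1) u) = poly (g i j h) u"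
      using kernel_polynomials[OF ij] by blast
    then show "\<exists>v :: nat \<Rightarrow> real poly. \<forall>h\<le>rtilde (rels I) (X i) (X j).
       degree (v h) = h \<and>
       matrix_smult (sqrt (real (card (X i)) * real (card (X j)))) (idempotent_of (X i) (X j) h) =
         entrywise_poly (X i) (X j) (v h)
           (matrix_smult (sqrt (real (card (X i)) * real (card (X j)))) (idempotent_of (X i) (X j) 1))"
      using sqrt_card_pos[OF ij] ij
      by (intro exI[of _ v]) (auto simp: le_rtilde_iff fun_eq_iff matrix_smult_def
          entrywise_poly_def idempotent_def)
  qed
qed (auto simp: coherent_configuration_rels fibers_rels symmetric_association_scheme_fiber
    block_basis_rels)

end

section \<open>Kernels on a union of designs\<close>

locale design_system =
  fixes m :: "nat \<Rightarrow> real" and I :: "nat set" and t :: "nat \<Rightarrow> nat" and X :: "nat \<Rightarrow> (real ^ 'd) set"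
  assumes finite_I: "finite I"
    and moments: "\<And>i. i \<in> I \<Longrightarrow> power_moments m (t i) (X i)"
    and disjoint: "\<And>i j. i \<in> I \<Longrightarrow> j \<in> I \<Longrightarrow> i \<noteq> j \<Longrightarrow> X i \<inter> X j = {}"
    and strength: "\<And>i j h. i \<in> I \<Longrightarrow> j \<in> I \<Longrightarrow> h \<in> I \<Longrightarrow>
      int (card (inner_products (X i) (X j))) + int (card (inner_products (X j) (X h))) - 2
        \<le> int (t j) \<or>
      (i = j \<and> j = h \<and> 2 * int (card (inner_products (X i) (X i))) - 3 = int (t i) \<and>
          X i = uminus ` X i)"
begin

section \<open>Numbers of inner products and the strength condition\<close>

definition s :: "nat \<Rightarrow> nat \<Rightarrow> nat" where
  "s i j = card (inner_products (X i) (X j))"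

definition ip :: "nat \<Rightarrow> nat \<Rightarrow> real set" where
  "ip i j = {x \<bullet> y | x y. x \<in> X i \<and> y \<in> X j}"

definition N :: "nat \<Rightarrow> nat \<Rightarrow> nat" where
  "N i j = card (ip i j)"

text \<open>The equation says that clause (1) fails by exactly one for \<open>i = j = h\<close>. A
  symmetric design of larger strength therefore belongs to the generic case.\<close>

definition antipodal :: "nat \<Rightarrow> bool" where
  "antipodal i \<longleftrightarrow> 2 * int (s i i) - 3 = int (t i) \<and> X i = uminus ` X i"

text \<open>The number of idempotents between \<open>X i\<close> and \<open>X j\<close> that are given by Gegenbauer polynomials.\<close>

definition c :: "nat \<Rightarrow> nat \<Rightarrow> nat" where
  "c i j = (if i \<noteq> j then s i j else if antipodal i then s i i - 1 else max 1 (s i i))"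

lemmas finite_X = power_momentsD(1)[OF moments]
  and X_nonempty = power_momentsD(2)[OF moments]
  and card_X_pos = power_momentsD(3)[OF moments]
  and norm_X = power_momentsD(4)[OF moments]

lemma finite_ip: "i \<in> I \<Longrightarrow> j \<in> I \<Longrightarrow> finite (ip i j)"
  unfolding ip_def using finite_X by (intro finite_image_set2) simp_all

lemma inner_eq_1_iff: "i \<in> I \<Longrightarrow> j \<in> I \<Longrightarrow> x \<in> X i \<Longrightarrow> y \<in> X j \<Longrightarrow> x \<bullet> y = 1 \<longleftrightarrow> x = y"
  using norm_X by (intro unit_inner_eq_1_iff)

lemma inner_products_offdiag: "i \<in> I \<Longrightarrow> j \<in> I \<Longrightarrow> i \<noteq> j \<Longrightarrow> inner_products (X i) (X j) = ip i j"
  using disjoint[of i j] unfolding inner_products_def ip_def by blast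

lemma ip_diag: "i \<in> I \<Longrightarrow> ip i i = insert 1 (inner_products (X i) (X i))"
  and one_notin_inner_products: "i \<in> I \<Longrightarrow> 1 \<notin> inner_products (X i) (X i)"
proof -
  assume i: "i \<in> I"
  show "1 \<notin> inner_products (X i) (X i)"
    using inner_eq_1_iff[OF i i] unfolding inner_products_def by auto
  obtain x where x: "x \<in> X i" using X_nonempty[OF i] by blast
  then have "1 = x \<bullet> x" using inner_eq_1_iff[OF i i x x] by simp
  then have "1 \<in> ip i i" using x unfolding ip_def by blast
  moreover have "u \<in> insert 1 (inner_products (X i) (X i))" if "u \<in> ip i i" for u
    using that inner_eq_1_iff[OF i i] unfolding inner_products_def ip_def by blast
  moreover have "inner_products (X i) (X i) \<subseteq> ip i i"
    unfolding inner_products_def ip_def by blast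
  ultimately show "ip i i = insert 1 (inner_products (X i) (X i))" by blast
qed

lemma s_commute: "s i j = s j i"
proof -
  have "inner_products (X i) (X j) \<subseteq> inner_products (X j) (X i)" for i j
  proof
    fix u assume "u \<in> inner_products (X i) (X j)"
    then obtain x y where xy: "x \<in> X i" "y \<in> X j" "y \<noteq> x" "u = x \<bullet> y"
      unfolding inner_products_def by blast
    then have "u = y \<bullet> x" by (simp add: inner_commute)
    with xy(1-3) show "u \<in> inner_products (X j) (X i)"
      unfolding inner_products_def by blast
  qed
  then have "inner_products (X i) (X j) = inner_products (X j) (X i)"
    by (intro subset_antisym)
  then show ?thesis by (simp add: s_def)
qed

lemma c_commute: "c i j = c j i"
  by (simp add: c_def s_commute)

lemma N_diag: "i \<in> I \<Longrightarrow> N i i = Suc (s i i)"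
  using finite_ip[of i i] one_notin_inner_products[of i] by (simp add: N_def s_def ip_diag)

lemma N_offdiag: "i \<in> I \<Longrightarrow> j \<in> I \<Longrightarrow> i \<noteq> j \<Longrightarrow> N i j = c i j"
  by (simp add: N_def c_def s_def inner_products_offdiag)

lemma s_offdiag_pos:
  assumes "i \<in> I" "j \<in> I" "i \<noteq> j"
  shows "0 < s i j"
proof -
  have "ip i j \<noteq> {}"
    using X_nonempty[OF assms(1)] X_nonempty[OF assms(2)] unfolding ip_def by blast
  then show ?thesis
    using finite_ip[OF assms(1,2)] by (simp add: s_def inner_products_offdiag[OF assms] card_gt_0_iff)
qed

lemma antipodal_ge_2: "antipodal i \<Longrightarrow> 2 \<le> s i i"
  by (auto simp: antipodal_def)

lemma c_pos: "i \<in> I \<Longrightarrow> j \<in> I \<Longrightarrow> 0 < c i j"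
  using s_offdiag_pos antipodal_ge_2[of i] by (auto simp: c_def)

lemma c_le_N: "i \<in> I \<Longrightarrow> j \<in> I \<Longrightarrow> c i j \<le> N i j"
  using N_offdiag[of i j] N_diag[of i] by (cases "i = j") (auto simp: c_def)

lemma strength_s:
  assumes "i \<in> I" "j \<in> I" "h \<in> I" "\<not> (i = j \<and> j = h \<and> antipodal i)"
  shows "s i j + s j h \<le> t j + 2"
  using strength[OF assms(1-3)] assms(4) by (auto simp: s_def antipodal_def)

text \<open>The form in which the hypothesis is applied: degrees below \<open>c i j\<close> and
  below \<open>c j h\<close> add up to at most \<open>t j\<close>. For a one-point design
  \<open>s j j = 0\<close> but \<open>c j j = 1\<close>, as its block still carries the constant
  kernel; the triple \<open>(j, j, h)\<close> is then too weak by one and \<open>(h, j, h)\<close>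
  is used, with \<open>s h j\<close> positive.\<close>

lemma strength_c:
  assumes I: "i \<in> I" "j \<in> I" "h \<in> I"
  shows "c i j + c j h \<le> t j + 2"
proof -
  have c_le: "c k l \<le> s k l" if "\<not> (k = l \<and> s k k = 0)" for k l
    using that by (auto simp: c_def)
  have c_zero: "c k k = 1" if "s k k = 0" for k
    using that antipodal_ge_2[of k] by (auto simp: c_def)
  have off: "2 * s k j \<le> t j + 2" "0 < s k j" if "k \<in> I" "k \<noteq> j" for k
    using strength_s[of k j k] s_offdiag_pos[of k j] s_commute[of j k] I that by auto
  consider "i = j" "j = h" | "i = j" "j \<noteq> h" "s j j = 0" | "i \<noteq> j" "j = h" "s j j = 0"
    | "\<not> (i = j \<and> j = h)" "\<not> (i = j \<and> s j j = 0)" "\<not> (j = h \<and> s j j = 0)" by fastforce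
  then show ?thesis
  proof cases
    case 1
    show ?thesis
    proof (cases "antipodal j")
      case True
      then have "2 * s j j = t j + 3" unfolding antipodal_def by linarith
      then show ?thesis using 1 True by (simp add: c_def)
    next
      case False
      then show ?thesis using 1 strength_s[OF I] by (simp add: c_def)
    qed
  next
    case 2
    moreover have "c j h \<le> s h j" using c_le[of j h] 2(2) s_commute[of j h] by simp
    ultimately show ?thesis
      using off[OF I(3)] c_zero[of j] by simp
  next
    case 3
    moreover have "c i j \<le> s i j" using c_le[of i j] 3(1) by simp
    ultimately show ?thesis
      using off[OF I(1)] c_zero[of j] by simp
  next
    case 4
    then have "s i j + s j h \<le> t j + 2" using strength_s[OF I] by blast
    moreover have "c i j \<le> s i j" "c j h \<le> s j h" using 4 c_le by auto
    ultimately show ?thesis by simp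
  qed
qed

lemma double_le_strength: "i \<in> I \<Longrightarrow> j \<in> I \<Longrightarrow> l < c i j \<Longrightarrow> 2 * l \<le> t i"
  using strength_c[of j i j] c_commute[of i j] by simp

text \<open>For distinct indices clause (1) for \<open>(i, i, j)\<close> reads
  \<open>s i i + s i j \<le> t i + 2\<close>, and the right side is \<open>2 * s i i - 1\<close>.
  Hence no block at \<open>X i\<close> uses a Gegenbauer polynomial of one of the two degrees that
  must be completed.\<close>

lemma antipodal_c_le: "i \<in> I \<Longrightarrow> j \<in> I \<Longrightarrow> antipodal i \<Longrightarrow> c i j \<le> s i i - 1"
  using strength_s[of i i j] by (cases "i = j") (auto simp: c_def antipodal_def)

end

locale design_kernels = design_system m I t X + zonal m T Z K
  for m :: "nat \<Rightarrow> real" and I t and X :: "nat \<Rightarrow> (real ^ 'd) set" and T and Z :: "(real ^ 'd) set"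
      and K +
  assumes c_le_K: "\<And>i j. i \<in> I \<Longrightarrow> j \<in> I \<Longrightarrow> c i j \<le> Suc K"
begin

lemma sum_G_G:
  assumes "i \<in> I" "j \<in> I" "h \<in> I" "l < c i j" "k < c j h" "norm x = 1" "norm y = 1"
  shows "(\<Sum>z\<in>X j. poly (gegenbauer l) (x \<bullet> z) * poly (gegenbauer k) (z \<bullet> y)) =
    (if l = k then real (card (X j)) * poly (gegenbauer l) (x \<bullet> y) else 0)"
proof (rule sum_gegenbauer_gegenbauer[OF _ _ moments[OF assms(2)] _ assms(6,7)])
  show "l \<le> K" using c_le_K[OF assms(1,2)] assms(4) by linarith
  show "k \<le> K" using c_le_K[OF assms(2,3)] assms(5) by linarith
  show "l + k \<le> t j" using strength_c[OF assms(1-3)] assms(4,5) by linarith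
qed

text \<open>Otherwise the polynomial of degree \<open>N i h\<close> that vanishes on \<open>ip i h\<close> would have norm \<open>0\<close>.\<close>

lemma less_N:
  assumes "i \<in> I" "h \<in> I" "l \<le> K" "2 * l \<le> t i"
  shows "l < N i h"
proof (rule ccontr)
  assume "\<not> l < N i h"
  define f where "f = (\<Prod>\<alpha>\<in>ip i h. [:- \<alpha>, 1:])"
  have f: "degree f = N i h" "\<And>u. poly f u = (\<Prod>\<alpha>\<in>ip i h. u - \<alpha>)"
    by (simp_all add: f_def N_def degree_prod_eq_sum_degree poly_prod)
  then have deg: "degree f \<le> K" "2 * degree f \<le> t i" using \<open>\<not> l < N i h\<close> assms by auto
  have "f \<noteq> 0" by (simp add: f_def prod_zero_iff finite_ip[OF assms(1,2)])
  obtain y where y: "y \<in> X h" using X_nonempty[OF assms(2)] by blast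
  have "z \<bullet> y \<in> ip i h" if "z \<in> X i" for z using y that by (auto simp: ip_def)
  then have "(\<Sum>z\<in>X i. poly f (y \<bullet> z) * poly f (z \<bullet> y)) = 0"
    using finite_ip[OF assms(1,2)] by (intro sum.neutral) (auto simp: f(2) prod_zero_iff)
  then have "poly (convolution f f) 1 = 0"
    using sum_convolution[OF moments[OF assms(1)], of f f y y] deg norm_X[OF assms(2) y]
        card_X_pos[OF assms(1)]
    by (simp add: dot_square_norm)
  then show False
    using pairing_pos[OF deg(1) \<open>f \<noteq> 0\<close>] pairing_convolution[OF deg(1) deg(1)] by simp
qed

text \<open>\<open>F l\<close> for \<open>c i i \<le> l < N i i\<close> replaces the Gegenbauer polynomials of degree too high for the
  strength of \<open>X i\<close>. The last conjunct covers idempotents within \<open>X i\<close> that also arise as products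
  through another \<open>X j\<close>, as Gegenbauer kernels.\<close>

definition completes :: "nat \<Rightarrow> (nat \<Rightarrow> real poly) \<Rightarrow> bool" where
  "completes i F \<longleftrightarrow> (\<forall>l. c i i \<le> l \<longrightarrow> l < N i i \<longrightarrow>
     degree (F l) = l \<and>
     (\<forall>h\<in>I. \<forall>k<c i h. \<forall>x\<in>X i. \<forall>y\<in>X h.
        (\<Sum>z\<in>X i. poly (F l) (x \<bullet> z) * poly (gegenbauer k) (z \<bullet> y)) =
          (if l = k then real (card (X i)) * poly (gegenbauer l) (x \<bullet> y) else 0)) \<and>
     (\<forall>k. c i i \<le> k \<longrightarrow> k < N i i \<longrightarrow> (\<forall>x\<in>X i. \<forall>y\<in>X i.
        (\<Sum>z\<in>X i. poly (F l) (x \<bullet> z) * poly (F k) (z \<bullet> y)) =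
          (if l = k then real (card (X i)) * poly (F l) (x \<bullet> y) else 0))) \<and>
     (\<forall>j\<in>I. l < c i j \<longrightarrow> (\<forall>u\<in>ip i i. poly (F l) u = poly (gegenbauer l) u)))"

section \<open>Completion of the diagonal blocks\<close>

lemma degree_sum_G:
  assumes "\<And>k. k \<in> M \<Longrightarrow> k \<le> K \<and> k < l" "0 < l"
  shows "degree (\<Sum>k\<in>M. gegenbauer k) < l"
proof -
  have "degree (\<Sum>k\<in>M. gegenbauer k) \<le> l - 1"
  proof (cases "finite M")
    case True
    then show ?thesis
      using assms degree_gegenbauer by (intro degree_sum_le) (auto simp: Suc_le_eq dest!: assms(1))
  qed simp
  with assms(2) show ?thesis by simp
qed

lemma degree_minus_sum_G:
  assumes "degree p = l" "\<And>k. k \<in> M \<Longrightarrow> k \<le> K \<and> k < l" "0 < l"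
  shows "degree (p - (\<Sum>k\<in>M. gegenbauer k)) = l"
  using degree_sum_G[OF assms(2,3)] assms(1) degree_add_eq_left[of "- (\<Sum>k\<in>M. gegenbauer k)" p] by simp

text \<open>\<open>L\<close> is 1 at 1 and 0 at the other inner products, so \<open>?n\<close> times
  \<open>L\<close> acts as the unit for convolution over \<open>X i\<close>. Subtracting the
  orthogonal idempotents of degree below \<open>?s\<close> leaves the complementary
  idempotent.\<close>

lemma completes_generic:
  assumes i: "i \<in> I" and np: "\<not> antipodal i" and s: "0 < s i i"
  shows "\<exists>F. completes i F"
proof -
  let ?s = "s i i" and ?n = "real (card (X i))"
  have c: "c i i = ?s" and N: "N i i = Suc ?s"
    using np s N_diag[OF i] by (simp_all add: c_def)
  obtain L where L: "degree L < N i i" "\<And>u. u \<in> ip i i \<Longrightarrow> poly L u = of_bool (u = 1)"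
    using poly_interpolation_exists[OF finite_ip[OF i i], of "\<lambda>u. of_bool (u = 1)"] N
        unfolding N_def by auto
  have L0: "L \<noteq> 0"
    using L(2)[of 1] ip_diag[OF i] by auto
  \<comment> \<open>\<open>L\<close> vanishes at the \<open>?s\<close> inner products other than 1,
    so a smaller degree would make it zero. Thus \<open>F\<close> has exactly the missing
    degree.\<close>
  have "\<not> degree L < card (inner_products (X i) (X i))"
  proof
    assume "degree L < card (inner_products (X i) (X i))"
    then have "L = 0"
      using L(2) ip_diag[OF i] one_notin_inner_products[OF i] by (intro poly_vanishing_eq_0) auto
    with L0 show False by simp
  qed
  then have degL: "degree L = ?s" using L(1) N by (simp add: s_def)
  define F where "F = smult ?n L - (\<Sum>k<?s. gegenbauer k)"
  have sK: "k \<le> K" if "k < ?s" for k using that c c_le_K[OF i i] by simp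
  have degF: "degree F = ?s"
    unfolding F_def using card_X_pos[OF i] degL sK s by (intro degree_minus_sum_G) auto
  have F: "poly F (x \<bullet> z) = (if z = x then ?n else 0) - (\<Sum>k<?s. poly (gegenbauer k) (x \<bullet> z))"
    if "x \<in> X i" "z \<in> X i" for x z
  proof -
    have "x \<bullet> z \<in> ip i i" using that unfolding ip_def by blast
    then show ?thesis
      using L(2)[of "x \<bullet> z"] inner_eq_1_iff[OF i i that] by (auto simp: F_def poly_sum)
  qed
  have sum_F: "(\<Sum>z\<in>X i. poly F (x \<bullet> z) * f z)
      = ?n * f x - (\<Sum>k<?s. \<Sum>z\<in>X i. poly (gegenbauer k) (x \<bullet> z) * f z)" if "x \<in> X i" for x f
  proof -
    have "(\<Sum>z\<in>X i. poly F (x \<bullet> z) * f z)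
      = (\<Sum>z\<in>X i. (if z = x then ?n * f x else 0) - (\<Sum>k<?s. poly (gegenbauer k) (x \<bullet> z) * f z))"
      using that by (intro sum.cong) (auto simp: F left_diff_distrib sum_distrib_right)
    also have "\<dots> = ?n * f x - (\<Sum>z\<in>X i. \<Sum>k<?s. poly (gegenbauer k) (x \<bullet> z) * f z)"
      using that finite_X[OF i] by (simp add: sum_subtractf)
    also have "(\<Sum>z\<in>X i. \<Sum>k<?s. poly (gegenbauer k) (x \<bullet> z) * f z)
        = (\<Sum>k<?s. \<Sum>z\<in>X i. poly (gegenbauer k) (x \<bullet> z) * f z)"
      by (rule sum.swap)
    finally show ?thesis .
  qed
  have FG: "(\<Sum>z\<in>X i. poly F (x \<bullet> z) * poly (gegenbauer k) (z \<bullet> y)) =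
      (if ?s = k then ?n * poly (gegenbauer ?s) (x \<bullet> y) else 0)"
    if "h \<in> I" "k < c i h" "x \<in> X i" "y \<in> X h" for h k x y
  proof -
    have "(\<Sum>l<?s. \<Sum>z\<in>X i. poly (gegenbauer l) (x \<bullet> z) * poly (gegenbauer k) (z \<bullet> y))
        = (\<Sum>l<?s. if l = k then ?n * poly (gegenbauer k) (x \<bullet> y) else 0)"
      using that i c norm_X by (intro sum.cong refl) (subst sum_G_G[of i i h], auto)
    also have "\<dots> = (if k < ?s then ?n * poly (gegenbauer k) (x \<bullet> y) else 0)" by simp
    finally have "(\<Sum>z\<in>X i. poly F (x \<bullet> z) * poly (gegenbauer k) (z \<bullet> y))
        = (if k < ?s then 0 else ?n * poly (gegenbauer k) (x \<bullet> y))"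
      using sum_F[OF that(3), of "\<lambda>z. poly (gegenbauer k) (z \<bullet> y)"] by simp
    \<comment> \<open>Another block may use degree \<open>?s\<close> itself, and then the sum
      reproduces the Gegenbauer kernel; \<open>less_N\<close> excludes anything larger.\<close>
    moreover have "k < Suc ?s"
      using less_N[OF i i, of k] double_le_strength[OF i that(1,2)] c_le_K[OF i that(1)] that(2) N
          by simp
    ultimately show ?thesis by auto
  qed
  have FF: "(\<Sum>z\<in>X i. poly F (x \<bullet> z) * poly F (z \<bullet> y)) = ?n * poly F (x \<bullet> y)"
    if "x \<in> X i" "y \<in> X i" for x y
  proof -
    have "(\<Sum>z\<in>X i. poly (gegenbauer k) (x \<bullet> z) * poly F (z \<bullet> y)) = 0" if k: "k < ?s" for k
      using FG[OF i, of k y x] k c \<open>x \<in> X i\<close> \<open>y \<in> X i\<close> by (simp add: inner_commute mult.commute)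
    then show ?thesis using sum_F[OF that(1), of "\<lambda>z. poly F (z \<bullet> y)"] by simp
  qed
  \<comment> \<open>Here \<open>2 * ?s \<le> t i\<close>, so the Gegenbauer rules hold over
    \<open>X i\<close> up to degree \<open>?s\<close>. Convolving the sum of all Gegenbauer kernels
    up to \<open>?s\<close> with \<open>L\<close> gives that sum, as \<open>L\<close> is a delta
    function, and also \<open>?n\<close> times \<open>L\<close>, as the sum acts as a unit on
    polynomials of degree up to \<open>?s\<close>. So \<open>?n\<close> times \<open>L\<close>
    equals the sum on \<open>ip i i\<close>.\<close>
  have F_eq_G: "poly F u = poly (gegenbauer ?s) u" if j: "j \<in> I" "?s < c i j" and u: "u \<in> ip i i"
      for j u
  proof -
    obtain x y where xy: "x \<in> X i" "y \<in> X i" "u = x \<bullet> y" using u by (auto simp: ip_def)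
    have sK: "?s \<le> K" and st: "2 * ?s \<le> t i"
      using double_le_strength[OF i j] c_le_K[OF i j(1)] j(2) by auto
    obtain a where a: "L = (\<Sum>k<Suc ?s. smult (a k) (gegenbauer k))"
      using poly_triangular_expansion[of "Suc ?s" gegenbauer L] degL sK degree_gegenbauer
          gegenbauer_nonzero by auto
    have L_xy: "poly L (z \<bullet> y) = (if z = y then 1 else 0)" if "z \<in> X i" for z
    proof -
      have "z \<bullet> y \<in> ip i i" using that xy(2) unfolding ip_def by blast
      then show ?thesis
        using L(2)[of "z \<bullet> y"] inner_eq_1_iff[OF i i that xy(2)] by auto
    qed
    have "(\<Sum>l<Suc ?s. poly (gegenbauer l) (x \<bullet> y))
        = (\<Sum>z\<in>X i. if z = y then \<Sum>l<Suc ?s. poly (gegenbauer l) (x \<bullet> y) else 0)"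
      using xy finite_X[OF i] by simp
    also have "\<dots> = (\<Sum>z\<in>X i. (\<Sum>l<Suc ?s. poly (gegenbauer l) (x \<bullet> z)) * poly L (z \<bullet> y))"
      by (intro sum.cong refl) (auto simp: L_xy simp del: sum.lessThan_Suc)
    also have "\<dots> = (\<Sum>z\<in>X i. \<Sum>l<Suc ?s. \<Sum>k<Suc ?s. a k
        * (poly (gegenbauer l) (x \<bullet> z) * poly (gegenbauer k) (z \<bullet> y)))"
      by (simp add: a poly_sum sum_product mult.left_commute del: sum.lessThan_Suc)
    also have "\<dots> = (\<Sum>l<Suc ?s. \<Sum>k<Suc ?s. a k * (\<Sum>z\<in>X i. poly (gegenbauer l) (x \<bullet> z) *
        poly (gegenbauer k) (z \<bullet> y)))"
      by (simp add: sum_distrib_left sum.swap[of _ "X i"] del: sum.lessThan_Suc)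
    also have "\<dots> = (\<Sum>l<Suc ?s. \<Sum>k<Suc ?s. if k
        = l then a k * (?n * poly (gegenbauer k) (x \<bullet> y)) else 0)"
      using sK st xy norm_X[OF i]
      by (intro sum.cong refl) (subst sum_gegenbauer_gegenbauer[OF _ _ moments[OF i]], auto)
    also have "\<dots> = ?n * poly L (x \<bullet> y)"
      by (simp add: a poly_sum sum_distrib_left mult.left_commute del: sum.lessThan_Suc cong: if_cong)
    finally show ?thesis by (simp add: F_def poly_sum xy(3))
  qed
  \<comment> \<open>\<open>?s\<close> is the only degree to complete, so a constant family
    does.\<close>
  have "completes i (\<lambda>_. F)"
    unfolding completes_def using c N degF FG FF F_eq_G by (auto simp: less_Suc_eq_le dest!: le_antisym)
  then show ?thesis by blast
qed

text \<open>Two degrees, \<open>?s - 1\<close> and \<open>?s\<close>, are missing. They have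
  opposite parity, and so do the two halves of the identity; from each half the Gegenbauer kernels
  of its own parity are subtracted.\<close>

lemma completes_antipodal:
  assumes i: "i \<in> I" and ap: "antipodal i"
  shows "\<exists>F. completes i F"
proof -
  let ?s = "s i i" and ?n = "real (card (X i))"
  have s2: "2 \<le> ?s" using ap by (rule antipodal_ge_2)
  have c: "c i i = ?s - 1" and N: "N i i = Suc ?s"
    using ap N_diag[OF i] by (simp_all add: c_def)
  have neg: "- x \<in> X i" if "x \<in> X i" for x
    using ap that unfolding antipodal_def by (metis imageI)
  define A where "A = inner_products (X i) (X i) - {- 1}"
  have "- 1 \<in> inner_products (X i) (X i)"
  proof -
    obtain x where x: "x \<in> X i" using X_nonempty[OF i] by blast
    then have "x \<bullet> (- x) = - 1" "x \<bullet> x = 1"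
      using norm_X[OF i x] by (simp_all add: dot_square_norm)
    moreover from this have "x \<noteq> - x" by (metis one_neq_neg_one)
    ultimately show ?thesis using x neg[OF x] unfolding inner_products_def
        by (smt (verit) mem_Collect_eq)
  qed
  then have ip: "ip i i = insert 1 (insert (- 1) A)" and card_A: "card A = ?s - 1"
    using ip_diag[OF i] finite_ip[OF i i] by (auto simp: A_def s_def)
  have one_A: "1 \<notin> A" using one_notin_inner_products[OF i] by (simp add: A_def)
  have fin_A: "finite A" using finite_ip[OF i i] ip by simp
  have "- u \<in> ip i i" if "u \<in> ip i i" for u
    using that neg unfolding ip_def by (smt (verit) inner_minus_left mem_Collect_eq)
  then have neg_A: "- u \<in> A" if "u \<in> A" for u
    using that ip one_A by (metis A_def DiffD2 equation_minus_iff insert_iff singletonI)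
  \<comment> \<open>The inner products other than 1 and -1 form a symmetric set, so \<open>Q\<close>
    has the parity of its degree \<open>?s - 1\<close>, and multiplying by the variable supplies the
    other parity in degree \<open>?s\<close>.\<close>
  define Q where "Q = (\<Prod>\<alpha>\<in>A. [:- \<alpha>, 1:])"
  have Q: "degree Q = ?s - 1" "\<And>u. poly Q u = (\<Prod>\<alpha>\<in>A. u - \<alpha>)"
    by (simp_all add: Q_def card_A degree_prod_eq_sum_degree poly_prod)
  have Q_neg: "poly Q (- u) = (-1) ^ (?s - 1) * poly Q u" for u
  proof -
    have "poly Q (- u) = (\<Prod>\<alpha>\<in>A. (- 1) * (u - (- \<alpha>)))" by (simp add: Q(2))
    also have "\<dots> = (-1) ^ (?s - 1) * (\<Prod>\<alpha>\<in>A. u - (- \<alpha>))"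
      by (simp only: prod.distrib prod_constant card_A)
    also have "(\<Prod>\<alpha>\<in>A. u - (- \<alpha>)) = (\<Prod>\<alpha>\<in>A. u - \<alpha>)"
      by (rule prod.reindex_bij_witness[of _ uminus uminus]) (auto simp: neg_A)
    finally show ?thesis by (simp add: Q(2))
  qed
  have Q1: "poly Q 1 \<noteq> 0" using one_A fin_A by (auto simp: Q(2))
  then have Q0: "Q \<noteq> 0" by auto
  \<comment> \<open>On \<open>ip i i\<close>, \<open>R l\<close> is supported at \<open>1\<close> and \<open>-1\<close> and has the parity of \<open>l\<close>, so \<open>smult a (R l)\<close> is
    the even or the odd part of the identity.\<close>
  define R where "R l = (if l = ?s then pCons 0 Q else Q)" for l
  define M where "M l = {k. k < ?s - 1 \<and> even (k + l)}" for l
  define a where "a = ?n / (2 * poly Q 1)"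
  define F where "F l = smult a (R l) - (\<Sum>k\<in>M l. gegenbauer k)" for l
  have a: "a \<noteq> 0" using Q1 card_X_pos[OF i] by (simp add: a_def)
  have cK: "k < ?s - 1 \<Longrightarrow> k \<le> K" for k using c_le_K[OF i i] c by simp
  have degF: "degree (F l) = l" if "l = ?s - 1 \<or> l = ?s" for l
    unfolding F_def using that Q(1) Q0 s2 a cK
    by (intro degree_minus_sum_G) (auto simp: R_def M_def)
  have R_neg: "poly (R l) (- u) = (-1) ^ l * poly (R l) u" if "l = ?s - 1 \<or> l = ?s" for l u
  proof -
    have "(-1) ^ ?s = - ((-1) ^ (?s - 1) :: real)" using s2 by (cases ?s) auto
    then show ?thesis using that by (auto simp: R_def Q_neg)
  qed
  have F_neg: "poly (F l) (- u) = (-1) ^ l * poly (F l) u" if "l = ?s - 1 \<or> l = ?s" for l u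
  proof -
    have "(\<Sum>k\<in>M l. poly (gegenbauer k) (- u)) = (-1) ^ l * (\<Sum>k\<in>M l. poly (gegenbauer k) u)"
      unfolding sum_distrib_left
      by (intro sum.cong refl)
        (auto simp: M_def gegenbauer_parity[OF cK] minus_one_power_iff)
    then show ?thesis
      by (simp add: F_def poly_sum R_neg[OF that] algebra_simps)
  qed
  have aR: "a * poly (R l) (x \<bullet> z) = ?n / 2 * ((if z = x then 1 else 0) + (-1) ^ l *
      (if z = - x then 1 else 0))"
    if l: "l = ?s - 1 \<or> l = ?s" and x: "x \<in> X i" "z \<in> X i" for l x z
  proof -
    have xx: "x \<bullet> x = 1" using norm_X[OF i x(1)] by (simp add: dot_square_norm)
    then have x': "x \<noteq> - x" by (metis inner_minus_right one_neq_neg_one)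
    have R1: "poly (R l) 1 = poly Q 1" by (simp add: R_def)
    consider "z = x" | "z = - x" | "z \<noteq> x" "z \<noteq> - x" by blast
    then show ?thesis
    proof cases
      case 1
      then show ?thesis using xx x' R1 Q1 by (simp add: a_def)
    next
      case 2
      then show ?thesis using xx x' R1 Q1 R_neg[OF l, of 1] by (auto simp: a_def)
    next
      case 3
      have "x \<bullet> z \<noteq> 1" using inner_eq_1_iff[OF i i x] 3 by auto
      moreover have "x \<bullet> z \<noteq> - 1"
        using inner_eq_1_iff[OF i i x(1) neg[OF x(2)]] 3 by auto
      moreover have "x \<bullet> z \<in> ip i i" using x by (auto simp: ip_def)
      ultimately have "x \<bullet> z \<in> A" using ip by simp
      then have "poly Q (x \<bullet> z) = 0" using fin_A by (auto simp: Q(2))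
      then show ?thesis using 3 by (simp add: R_def)
    qed
  qed
  have sum_F: "(\<Sum>z\<in>X i. poly (F l) (x \<bullet> z) * f z)
      = ?n / 2 * (f x + (-1) ^ l * f (- x)) - (\<Sum>k\<in>M l. \<Sum>z\<in>X i. poly (gegenbauer k) (x \<bullet> z) * f z)"
    if l: "l = ?s - 1 \<or> l = ?s" and x: "x \<in> X i" for l x f
  proof -
    have "(\<Sum>z\<in>X i. poly (F l) (x \<bullet> z) * f z)
      = (\<Sum>z\<in>X i. (if z = x then ?n / 2 * f x else 0) +
          (if z = - x then ?n / 2 * (-1) ^ l * f (- x) else 0)
          - (\<Sum>k\<in>M l. poly (gegenbauer k) (x \<bullet> z) * f z))"
    proof (intro sum.cong refl)
      fix z assume z: "z \<in> X i"
      have "x \<bullet> x = 1" using norm_X[OF i x] by (simp add: dot_square_norm)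
      then have x': "x \<noteq> - x" by (metis inner_minus_right one_neq_neg_one)
      have "poly (F l) (x \<bullet> z)
          = ?n / 2 * ((if z = x then 1 else 0) + (-1) ^ l *
              (if z = - x then 1 else 0)) - (\<Sum>k\<in>M l. poly (gegenbauer k) (x \<bullet> z))"
        unfolding aR[OF l x z, symmetric] by (simp add: F_def poly_sum)
      then show "poly (F l) (x \<bullet> z) * f z
          = (if z = x then ?n / 2 * f x else 0) + (if z = - x then ?n / 2 * (-1) ^ l * f (- x) else 0)
          - (\<Sum>k\<in>M l. poly (gegenbauer k) (x \<bullet> z) * f z)"
        using x' by (simp add: left_diff_distrib sum_distrib_right)
    qed
    also have "\<dots> = ?n / 2 * f x + ?n / 2 * (-1) ^ l * f (- x)
          - (\<Sum>z\<in>X i. \<Sum>k\<in>M l. poly (gegenbauer k) (x \<bullet> z) * f z)"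
      using x neg[OF x] finite_X[OF i] by (simp add: sum_subtractf sum.distrib)
    also have "(\<Sum>z\<in>X i. \<Sum>k\<in>M l. poly (gegenbauer k) (x \<bullet> z) * f z)
        = (\<Sum>k\<in>M l. \<Sum>z\<in>X i. poly (gegenbauer k) (x \<bullet> z) * f z)"
      by (rule sum.swap)
    finally show ?thesis by (simp add: algebra_simps)
  qed
  \<comment> \<open>If \<open>k\<close> and \<open>l\<close> have equal parity, the half identity
    reproduces the Gegenbauer kernel and the subtracted term of index \<open>k\<close> removes it.
    Otherwise the contributions of \<open>x\<close> and \<open>- x\<close> cancel.\<close>
  have FG: "(\<Sum>z\<in>X i. poly (F l) (x \<bullet> z) * poly (gegenbauer k) (z \<bullet> y)) = 0"
    if l: "l = ?s - 1 \<or> l = ?s" and h: "h \<in> I" "k < c i h" "x \<in> X i" "y \<in> X h" for l h k x y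
  proof -
    have k: "k < ?s - 1" using antipodal_c_le[OF i h(1) ap] h(2) by simp
    have "(\<Sum>j\<in>M l. \<Sum>z\<in>X i. poly (gegenbauer j) (x \<bullet> z) * poly (gegenbauer k) (z \<bullet> y))
        = (\<Sum>j\<in>M l. if j = k then ?n * poly (gegenbauer k) (x \<bullet> y) else 0)"
      using h i c norm_X by (intro sum.cong refl) (subst sum_G_G[of i i h], auto simp: M_def)
    also have "\<dots> = (if even (k + l) then ?n * poly (gegenbauer k) (x \<bullet> y) else 0)"
      using k by (simp add: M_def)
    finally show ?thesis
      using sum_F[OF l h(3), of "\<lambda>z. poly (gegenbauer k) (z \<bullet> y)"] gegenbauer_parity[OF cK[OF k]]
      by (auto simp: minus_one_power_iff)
  qed
  have FF: "(\<Sum>z\<in>X i. poly (F l) (x \<bullet> z) * poly (F k) (z \<bullet> y)) =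
      (if l = k then ?n * poly (F l) (x \<bullet> y) else 0)"
    if l: "l = ?s - 1 \<or> l = ?s" and k: "k = ?s - 1 \<or> k = ?s" and xy: "x \<in> X i" "y \<in> X i" for l k x y
  proof -
    have "(\<Sum>z\<in>X i. poly (gegenbauer j) (x \<bullet> z) * poly (F k) (z \<bullet> y)) = 0" if "j \<in> M l" for j
      using FG[OF k i, of j y x] that c xy by (simp add: M_def inner_commute mult.commute)
    then have "(\<Sum>z\<in>X i. poly (F l) (x \<bullet> z) * poly (F k) (z \<bullet> y))
        = ?n / 2 * (poly (F k) (x \<bullet> y) + (-1) ^ l * ((-1) ^ k * poly (F k) (x \<bullet> y)))"
      using sum_F[OF l xy(1), of "\<lambda>z. poly (F k) (z \<bullet> y)"] by (simp add: F_neg[OF k])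
    \<comment> \<open>Consecutive degrees differ in parity, so the two completed kernels annihilate
      each other.\<close>
    moreover have "even l = even k \<longleftrightarrow> l = k" using l k s2 by auto
    ultimately show ?thesis
      by (cases "even l"; cases "even k") (auto simp: minus_one_power_iff)
  qed
  have range: "l = ?s - 1 \<or> l = ?s" if "c i i \<le> l" "l < N i i" for l
    using that c N by auto
  \<comment> \<open>By \<open>antipodal_c_le\<close> the completed degrees never meet a Gegenbauer
    degree in use, so the agreement clause of \<open>completes\<close> is vacuous here.\<close>
  have big: "\<not> l < c i j" "l \<noteq> k" if "c i i \<le> l" "j \<in> I" "k < c i j" for l j k
    using antipodal_c_le[OF i that(2) ap] that(1,3) c by linarith+
  have "completes i F"
    unfolding completes_def
  proof (intro allI impI conjI ballI)
    fix l assume l: "c i i \<le> l" "l < N i i"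
    note lr = range[OF l]
    show "degree (F l) = l" using degF lr by blast
    show "(\<Sum>z\<in>X i. poly (F l) (x \<bullet> z) * poly (gegenbauer k) (z \<bullet> y)) =
          (if l = k then ?n * poly (gegenbauer l) (x \<bullet> y) else 0)"
      if "h \<in> I" "k < c i h" "x \<in> X i" "y \<in> X h" for h k x y
      using FG[OF lr that] big[OF l(1) that(1,2)] by simp
    show "(\<Sum>z\<in>X i. poly (F l) (x \<bullet> z) * poly (F k) (z \<bullet> y)) =
          (if l = k then ?n * poly (F l) (x \<bullet> y) else 0)"
      if "c i i \<le> k" "k < N i i" "x \<in> X i" "y \<in> X i" for k x y
      using FF[OF lr range[OF that(1,2)] that(3,4)] .
    show "poly (F l) u = poly (gegenbauer l) u" if "j \<in> I" "l < c i j" "u \<in> ip i i" for j u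
      using big[OF l(1) that(1,2)] by simp
  qed
  then show ?thesis by blast
qed

lemma completes_exists:
  assumes i: "i \<in> I"
  shows "\<exists>F. completes i F"
proof -
  consider "antipodal i" | "\<not> antipodal i" "0 < s i i" | "\<not> antipodal i" "s i i = 0" by blast
  then show ?thesis
  proof cases
    \<comment> \<open>A one-point design: the constant kernel already fills its block.\<close>
    case 3
    then have "c i i = N i i" using N_diag[OF i] by (simp add: c_def)
    then show ?thesis by (simp add: completes_def)
  qed (use completes_antipodal completes_generic i in blast)+
qed

section \<open>Assembling the kernels of all blocks\<close>

lemma kernel_system_exists: "\<exists>g. kernel_system I X g"
proof -
  obtain F where F: "\<And>i. i \<in> I \<Longrightarrow> completes i (F i)"
    using completes_exists by metis
  define g where "g i j l = (if i = j \<and> c i i \<le> l then F i l else gegenbauer l)" for i j l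
  have deg: "degree (g i j l) = l" if "i \<in> I" "j \<in> I" "l < N i j" for i j l
  proof (cases "l < c i j")
    case True
    then show ?thesis using that c_le_K[of i j] by (auto simp: g_def degree_gegenbauer)
  next
    case False
    then have "i = j" using that N_offdiag[of i j] by auto
    then show ?thesis using False that F[OF that(1)] by (auto simp: g_def completes_def)
  qed
  have N_min: "l < N i h" if "i \<in> I" "j \<in> I" "h \<in> I" "l < N i j" "l < N j h" for i j h l
  proof (cases "i = j \<or> j = h")
    case False
    then have "l < c i j" using that N_offdiag[of i j] by auto
    then show ?thesis
      using less_N[of i h l] double_le_strength[of i j l] c_le_K[of i j] that by auto
  qed (use that in auto)
  have conv: "(\<Sum>z\<in>X j. poly (g i j l) (x \<bullet> z) * poly (g j h k) (z \<bullet> y)) =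
        (if l = k then real (card (X j)) * poly (g i h l) (x \<bullet> y) else 0)"
    if I: "i \<in> I" "j \<in> I" "h \<in> I" and l: "l < N i j" and k: "k < N j h" and xy: "x \<in> X i" "y \<in> X h"
    for i j h l k x y
  proof -
    consider "l < c i j" "k < c j h" | "i = j" "c i i \<le> l" "k < c j h"
      | "l < c i j" "j = h" "c j j \<le> k" | "i = j" "j = h" "c i i \<le> l" "c i i \<le> k"
      using N_offdiag l k I by (metis not_le)
    then show ?thesis
    proof cases
      case 1
      then have g: "g i j l = gegenbauer l" "g j h k = gegenbauer k" by (auto simp: g_def)
      \<comment> \<open>The consistency point: for \<open>i = h\<close> the target block may carry
        \<open>F i l\<close> where the path through \<open>X j\<close> produced a Gegenbauer kernel.
        The last conjunct of \<open>completes\<close> identifies them on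
        \<open>ip i i\<close>.\<close>
      have "poly (gegenbauer l) (x \<bullet> y) = poly (g i h l) (x \<bullet> y)" if lk: "l = k"
      proof (cases "i = h \<and> c i i \<le> l")
        case True
        then have "l < N i i" using N_min[of i j i l] I l k lk by simp
        moreover have "x \<bullet> y \<in> ip i i" using xy True by (auto simp: ip_def)
        ultimately show ?thesis
          using F[OF I(1)] True 1 I unfolding completes_def g_def by auto
      qed (auto simp: g_def)
      then show ?thesis
        using sum_G_G[OF I 1] xy norm_X I by (simp add: g)
    next
      case 2
      then have g: "g i j l = F i l" "g j h k = gegenbauer k" by (auto simp: g_def)
      moreover have "g i h l = gegenbauer l" if "l = k" using 2 that by (auto simp: g_def)
      ultimately show ?thesis
        using F[OF I(1)] 2 I l xy unfolding completes_def by auto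
    next
      case 3
      then have g: "g i j l = gegenbauer l" "g j h k = F j k" by (auto simp: g_def)
      have gl: "g i h l = gegenbauer l" if "l = k" using 3 that by (auto simp: g_def)
      \<comment> \<open>The mirror image of the previous case, with the sum read from
        \<open>y\<close> to \<open>x\<close>.\<close>
      have "(\<Sum>z\<in>X j. poly (F j k) (y \<bullet> z) * poly (gegenbauer l) (z \<bullet> x)) =
        (if k = l then real (card (X j)) * poly (gegenbauer k) (y \<bullet> x) else 0)"
        using F[OF I(2)] 3 I k xy c_commute[of i j] unfolding completes_def by auto
      then show ?thesis
        using gl by (auto simp: g inner_commute mult.commute)
    next
      case 4
      then have "g i j l = F i l" "g j h k = F i k" "g i h l = F i l" by (auto simp: g_def)
      then show ?thesis
        using F[OF I(1)] 4 I l k xy unfolding completes_def by auto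
    qed
  qed
  have "kernel_system I X g"
  proof (rule kernel_system.intro)
    show "g i j 0 = 1" if "i \<in> I" "j \<in> I" for i j
      using c_pos[OF that] by (auto simp: g_def gegenbauer_0)
    show "i = j" if "i \<in> I" "j \<in> I" "x \<in> X i" "x \<in> X j" for i j x
      using disjoint that by blast
    show "g i j l = g j i l" for i j l by (cases "i = j") (simp_all add: g_def)
  qed (fact finite_I finite_X X_nonempty norm_X deg[unfolded N_def ip_def]
      conv[unfolded N_def ip_def] N_min[unfolded N_def ip_def])+
  then show ?thesis by blast
qed

end

context design_system
begin

text \<open>The reference design \<open>X b\<close> comes from a pair that maximises
  \<open>c a b\<close>. All Gegenbauer degrees in use are then at most \<open>c a b - 1\<close>,
  \<open>strength_c\<close> for \<open>(a, b, a)\<close> gives \<open>X b\<close> twice that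
  strength, and the at least \<open>c a b\<close> inner products between \<open>X a\<close> and
  \<open>X b\<close> separate polynomials up to that degree.\<close>

lemma kernel_system: "\<exists>g. kernel_system I X g"
proof (cases "I = {}")
  case True
  then show ?thesis by (auto simp: kernel_system_def)
next
  case False
  define C where "C = (\<lambda>(i, j). c i j) ` (I \<times> I)"
  have C: "finite C" "C \<noteq> {}" using finite_I False by (auto simp: C_def)
  obtain a b where ab: "a \<in> I" "b \<in> I" "Max C = c a b"
    using Max_in[OF C] by (auto simp: C_def)
  have le: "c i j \<le> c a b" if "i \<in> I" "j \<in> I" for i j
    using Max_ge[OF C(1), of "c i j"] that ab(3) by (auto simp: C_def)
  interpret design_kernels m I t X "t b" "X b" "c a b - 1"
  proof unfold_locales
    show "power_moments m (t b) (X b)" using moments ab by blast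
    show "2 * (c a b - 1) \<le> t b" using strength_c[of a b a] c_commute[of a b] ab by simp
    show "c i j \<le> Suc (c a b - 1)" if "i \<in> I" "j \<in> I" for i j
      using le[OF that] by simp
    fix p :: "real poly" assume p: "degree p \<le> c a b - 1"
      "\<And>x y :: real ^ 'd. norm x = 1 \<Longrightarrow> norm y = 1 \<Longrightarrow> poly p (x \<bullet> y) = 0"
    show "p = 0"
    proof (rule poly_vanishing_eq_0)
      show "degree p < card (ip a b)"
        using p(1) c_le_N[OF ab(1,2)] c_pos[OF ab(1,2)] by (simp add: N_def)
      show "poly p u = 0" if "u \<in> ip a b" for u
        using that p(2) norm_X ab unfolding ip_def by auto
    qed
  qed
  show ?thesis by (rule kernel_system_exists)
qed

end

theorem theorem5p10:
  fixes n :: nat and t :: "nat \<Rightarrow> nat" and X :: "nat \<Rightarrow> (real ^ 'd) set"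
  assumes "\<And>i. i \<in> {1..n} \<Longrightarrow> spherical_design (t i) (X i)"
    and "\<And>i j. i \<in> {1..n} \<Longrightarrow> j \<in> {1..n} \<Longrightarrow> i \<noteq> j \<Longrightarrow> X i \<inter> X j = {}"
    and "\<And>i j h. i \<in> {1..n} \<Longrightarrow> j \<in> {1..n} \<Longrightarrow> h \<in> {1..n} \<Longrightarrow>
           int (card (inner_products (X i) (X j))) + int (card (inner_products (X j) (X h))) - 2
             \<le> int (t j) \<or>
           (i = j \<and> j = h \<and> 2 * int (card (inner_products (X i) (X i))) - 3 = int (t i) \<and>
            X i = uminus ` X i)"
  shows "Q_polynomial_coherent_configuration (\<Union>i\<in>{1..n}. X i) (design_relations n X)"
proof -
  obtain m where m: "\<And>t Y. spherical_design t (Y :: (real ^ 'd) set) \<Longrightarrow> power_moments m t Y"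
    using spherical_design_power_moments by blast
  interpret design_system m "{1..n}" t X
    using assms m by unfold_locales auto
  obtain g where "kernel_system {1..n} X g" using kernel_system by blast
  then interpret ks: kernel_system "{1..n}" X g "\<lambda>i j. {x \<bullet> y | x y. x \<in> X i \<and> y \<in> X j}"
      "\<lambda>i j. card {x \<bullet> y | x y. x \<in> X i \<and> y \<in> X j}" .
  \<comment> \<open>\<open>inner_products\<close> omits coinciding points, so
    \<open>design_relations\<close> lists the diagonals separately; in \<open>ks.rels\<close> they
    are the relations with inner product 1.\<close>
  have rels: "design_relations n X = ks.rels {1..n}"
  proof -
    have "{(x, x) | x. x \<in> X i} = ks.rel i i 1" if "i \<in> {1..n}" for i
      using ks.rel_diagonal(1)[OF that] by auto
    then have "{{(x, x) | x. x \<in> X i} | i. i \<in> {1..n}} = {ks.rel i i 1 | i. i \<in> {1..n}}"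
      by (metis (no_types, lifting))
    then have "design_relations n X = {ks.rel i i 1 | i. i \<in> {1..n}} \<union>
        {ks.rel i j \<alpha> | i j \<alpha>. i \<in> {1..n} \<and> j \<in> {1..n} \<and> \<alpha> \<in> inner_products (X i) (X j)}"
      unfolding design_relations_def by (simp only: ks.rel_def)
    also have "\<dots> = {ks.rel i j \<alpha> | i j \<alpha>. i \<in> {1..n} \<and> j \<in> {1..n} \<and> \<alpha> \<in> ip i j}" (is "?A \<union> ?B = ?C")
    proof -
      have ip: "ip i j = (if i = j then insert 1 (inner_products (X i) (X j))
          else inner_products (X i) (X j))"
        if "i \<in> {1..n}" "j \<in> {1..n}" for i j
        using that ip_diag inner_products_offdiag by auto
      have A: "R \<in> ?C" if mem: "R \<in> ?A" for R
      proof -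
        obtain i where R: "R = ks.rel i i 1" "i \<in> {1..n}" using mem by blast
        moreover have "1 \<in> ip i i" using ip[OF R(2,2)] by simp
        ultimately show ?thesis by blast
      qed
      have B: "R \<in> ?C" if mem: "R \<in> ?B" for R
      proof -
        obtain i j \<alpha> where R: "R = ks.rel i j \<alpha>" "i \<in> {1..n}" "j \<in> {1..n}"
            "\<alpha> \<in> inner_products (X i) (X j)"
          using mem by blast
        moreover have "\<alpha> \<in> ip i j" using ip[OF R(2,3)] R(4) by (cases "i = j") simp_all
        ultimately show ?thesis by blast
      qed
      have C: "R \<in> ?A \<union> ?B" if mem: "R \<in> ?C" for R
      proof -
        obtain i j \<alpha> where R: "R = ks.rel i j \<alpha>" "i \<in> {1..n}" "j \<in> {1..n}" "\<alpha> \<in> ip i j"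
          using mem by blast
        show ?thesis
        proof (cases "i = j \<and> \<alpha> = 1")
          case False
          then have "\<alpha> \<in> inner_products (X i) (X j)"
            using R(4) ip[OF R(2,3)] by (cases "i = j") simp_all
          with R show ?thesis by blast
        qed (use R in blast)
      qed
      show ?thesis
        by (intro subset_antisym subsetI, erule UnE, erule A, erule B, erule C)
    qed
    finally show ?thesis unfolding ks.rels_def ip_def .
  qed
  show ?thesis unfolding rels by (rule ks.Q_polynomial_rels)
qed

end
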